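(* Let $\mathcal{C}$ be a model bicategory, let $f,g:X\to Y$ be arrows of $\mathcal{C}$, and let $H:f\rightsquigarrow g$ be a fibrant left $w$-homotopy. Then there is a fibrant left $q$-homotopy $H':f\rightsquigarrow g$ such that $H'$ is germ related to $H$ (written $H'\underset{g}{\sim}> H$).
   Context: **Conventions.** $\circ$ is vertical composition, $\ast$ is horizontal composition (also composition of arrows); $\ast$ binds tighter than $\circ$; associators and unitors are suppressed. biLimits are bicategorical limits (universal property up to equivalence of hom-categories); the biPullback of $B\xrightarrow{f}D\xleftarrow{g}C$ is the bi-universal square over it commuting up to an invertible 2-cell. $\amalg$ is the bicoproduct, $\binom{f}{g}$ the induced arrow. **Lifting property.** Let $i:A\to X$, $p:Y\to B$. Let $\mathbf{P}$ be the category with objects triples $(a,\gamma,b)$, $a:A\to Y$, $b:X\to B$, $\gamma: p\ast a\Rightarrow b\ast i$ invertible, and arrows $(a,\gamma,b)\to(a',\gamma',b')$ the pairs of 2-cells $\alpha:a\Rightarrow a'$, $\beta:b\Rightarrow b'$ with $\beta\ast i\circ\gamma=\gamma'\circ p\ast\alpha$. Let $h:\mathcal{C}(X,Y)\to\mathbf{P}$, $h(f)=(f\ast i,\cong,p\ast f)$. The pair $(i,p)$ has the lifting property if $h$ is essentially surjective and essentially full, where $F:\mathbf{X}\to\mathbf{A}$ is essentially full if for every $g:FX\to FY$ there are $f:X'\to Y'$ and isomorphisms $a:FX'\to FX$, $b:FY'\to FY$ with $g\circ a=b\circ Ff$. **Model bicategory.** A bicategory $\mathcal{C}$ with three classes of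 arrows $\mathcal{F}$ (fibrations), $co\mathcal{F}$ (cofibrations), $\mathcal{W}$ (weak equivalences) such that: (M0) $\mathcal{C}$ has biterminal objects, biPullbacks and the dual colimits. (M1) If $i$ is a cofibration, $p$ a fibration and one of them is a weak equivalence, $(i,p)$ has the lifting property. (M2) Every arrow $f$ factors as $f\cong p\ast i$ with $i$ a cofibration, $p$ a fibration; in addition one may require $i$ to be a weak equivalence, or one may require $p$ to be so. (M3) Fibrations (cofibrations) are closed under composition and biPullbacks (biPushouts); every equivalence is a fibration and a cofibration; both classes are closed under invertible 2-cells $f\cong g$. (M4) A biPullback of a fibration in $\mathcal{W}$ is in $\mathcal{W}$; a biPushout of a cofibration in $\mathcal{W}$ is in $\mathcal{W}$. (M5) If $gf\cong h$ and two of $f,g,h$ are in $\mathcal{W}$, so is the third; every equivalence is in $\mathcal{W}$. **Homotopies.** A $w$-cylinder for $X$ is $C=(W,Z,d_0,d_1,x,s,\alpha_0,\alpha_1)$ with $d_0,d_1:X\to W$, $x:X\to Z$, $s:W\to Z$ in $\mathcal{W}$, and invertible $\alpha_j:s\ast d_j\Rightarrow x$. It is a $q$-cylinder if $Z=X$, $x=id_X$ and $\binom{d_0}{d_1}:X\amalg X\to W$ is a cofibration. A left $w$-homotopy $H:f\rightsquigarrow g$ between $f,g:X\to Y$ is $H=(C,h,\eta,\varepsilon)$, $C$ a $w$-cylinder for $X$, $h:W\to Y$, $\eta:f\Rightarrow h\ast d_0$, $\varepsilon:h\ast d_1\Rightarrow g$ (2-cells not necessarily invertible). It is a $q$-homotopy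 if $C$ is a $q$-cylinder, and fibrant if $s$ is a fibration. **Germ relation.** A morphism $M:C^1\to C^2$ between $w$-cylinders $C^j=(W^j,Z^j,d^j_0,d^j_1,x^j,s^j,\alpha^j_0,\alpha^j_1)$ for $X$ is $M=(k,l,\gamma_0,\gamma_1,\mu,\nu)$ with arrows $k:W^1\to W^2$, $l:Z^1\to Z^2$ and invertible 2-cells $\gamma_j:d^2_j\Rightarrow k\ast d^1_j$ ($j=0,1$), $\mu:s^2\ast k\Rightarrow l\ast s^1$, $\nu:x^2\Rightarrow l\ast x^1$ such that $(l\ast\alpha^1_j)\circ(\mu\ast d^1_j)\circ(s^2\ast\gamma_j)=\nu\circ\alpha^2_j$ for $j=0,1$. Given left $w$-homotopies $H^j=(C^j,h^j,\eta^j,\varepsilon^j):f\rightsquigarrow g$, $j=1,2$, $H^1$ is germ related to $H^2$, denoted $H^1\underset{g}{\sim}>H^2$, if there are a morphism $M:C^1\to C^2$ and an invertible 2-cell $\rho:h^2\ast k\Rightarrow h^1$ with $\eta^1=(\rho\ast d^1_0)\circ(h^2\ast\gamma_0)\circ\eta^2$ and $\varepsilon^1=\varepsilon^2\circ(h^2\ast\gamma_1^{-1})\circ(\rho^{-1}\ast d^1_1)$. *)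

theory Defs
  imports Main
begin

section \<open>Categories and functors given by families of hom-sets\<close>

text \<open>
  Hom-sets over different pairs of objects need not be disjoint, and therefore the action of a
  functor on a morphism takes the source and target of that morphism as arguments.
\<close>

record ('x, 'm) cat =
  Ob :: "'x set"
  Hom :: "'x \<Rightarrow> 'x \<Rightarrow> 'm set"
  Cmp :: "'m \<Rightarrow> 'm \<Rightarrow> 'm"
  Idm :: "'x \<Rightarrow> 'm"

record ('x, 'm, 'y, 'n) ftor =
  on_ob :: "'x \<Rightarrow> 'y"
  on_hom :: "'x \<Rightarrow> 'x \<Rightarrow> 'm \<Rightarrow> 'n"

definition cat_iso :: "('x, 'm) cat \<Rightarrow> 'x \<Rightarrow> 'x \<Rightarrow> 'm \<Rightarrow> bool" where
  "cat_iso A x y f \<longleftrightarrow> f \<in> Hom A x y \<and>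
     (\<exists>g \<in> Hom A y x. Cmp A g f = Idm A x \<and> Cmp A f g = Idm A y)"

definition is_functor :: "('x, 'm) cat \<Rightarrow> ('y, 'n) cat \<Rightarrow> ('x, 'm, 'y, 'n) ftor \<Rightarrow> bool" where
  "is_functor A B F \<longleftrightarrow>
     (\<forall>x \<in> Ob A. on_ob F x \<in> Ob B) \<and>
     (\<forall>x \<in> Ob A. \<forall>y \<in> Ob A. \<forall>f \<in> Hom A x y.
        on_hom F x y f \<in> Hom B (on_ob F x) (on_ob F y)) \<and>
     (\<forall>x \<in> Ob A. on_hom F x x (Idm A x) = Idm B (on_ob F x)) \<and>
     (\<forall>x \<in> Ob A. \<forall>y \<in> Ob A. \<forall>z \<in> Ob A. \<forall>f \<in> Hom A x y. \<forall>g \<in> Hom A y z.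
        on_hom F x z (Cmp A g f) = Cmp B (on_hom F y z g) (on_hom F x y f))"

definition id_ftor :: "('x, 'm, 'x, 'm) ftor" where
  "id_ftor = \<lparr>on_ob = (\<lambda>x. x), on_hom = (\<lambda>x y f. f)\<rparr>"

definition comp_ftor ::
  "('y, 'n, 'z, 'p) ftor \<Rightarrow> ('x, 'm, 'y, 'n) ftor \<Rightarrow> ('x, 'm, 'z, 'p) ftor" where
  "comp_ftor G F = \<lparr>on_ob = (\<lambda>x. on_ob G (on_ob F x)),
     on_hom = (\<lambda>x y f. on_hom G (on_ob F x) (on_ob F y) (on_hom F x y f))\<rparr>"

definition nat_isomorphic ::
  "('x, 'm) cat \<Rightarrow> ('y, 'n) cat \<Rightarrow> ('x, 'm, 'y, 'n) ftor \<Rightarrow> ('x, 'm, 'y, 'n) ftor \<Rightarrow> bool" where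
  "nat_isomorphic A B F G \<longleftrightarrow> (\<exists>\<tau>.
     (\<forall>x \<in> Ob A. cat_iso B (on_ob F x) (on_ob G x) (\<tau> x)) \<and>
     (\<forall>x \<in> Ob A. \<forall>y \<in> Ob A. \<forall>f \<in> Hom A x y.
        Cmp B (\<tau> y) (on_hom F x y f) = Cmp B (on_hom G x y f) (\<tau> x)))"

definition is_cat_equivalence ::
  "('x, 'm) cat \<Rightarrow> ('y, 'n) cat \<Rightarrow> ('x, 'm, 'y, 'n) ftor \<Rightarrow> bool" where
  "is_cat_equivalence A B F \<longleftrightarrow> is_functor A B F \<and>
     (\<exists>G. is_functor B A G \<and>
        nat_isomorphic A A (comp_ftor G F) id_ftor \<and>
        nat_isomorphic B B (comp_ftor F G) id_ftor)"

definition ess_surjective :: "('x, 'm) cat \<Rightarrow> ('y, 'n) cat \<Rightarrow> ('x, 'm, 'y, 'n) ftor \<Rightarrow> bool" where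
  "ess_surjective A B F \<longleftrightarrow> (\<forall>y \<in> Ob B. \<exists>x \<in> Ob A. \<exists>f. cat_iso B (on_ob F x) y f)"

definition ess_full :: "('x, 'm) cat \<Rightarrow> ('y, 'n) cat \<Rightarrow> ('x, 'm, 'y, 'n) ftor \<Rightarrow> bool" where
  "ess_full A B F \<longleftrightarrow>
     (\<forall>x \<in> Ob A. \<forall>y \<in> Ob A. \<forall>g \<in> Hom B (on_ob F x) (on_ob F y).
        \<exists>x' \<in> Ob A. \<exists>y' \<in> Ob A. \<exists>f \<in> Hom A x' y'. \<exists>a b.
          cat_iso B (on_ob F x') (on_ob F x) a \<and> cat_iso B (on_ob F y') (on_ob F y) b \<and>
          Cmp B g a = Cmp B b (on_hom F x' y' f))"

definition terminal_cat :: "(unit, unit) cat" where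
  "terminal_cat = \<lparr>Ob = UNIV, Hom = (\<lambda>_ _. UNIV), Cmp = (\<lambda>_ _. ()), Idm = (\<lambda>_. ())\<rparr>"

definition to_terminal :: "('x, 'm, unit, unit) ftor" where
  "to_terminal = \<lparr>on_ob = (\<lambda>_. ()), on_hom = (\<lambda>_ _ _. ())\<rparr>"

definition prod_cat :: "('x, 'm) cat \<Rightarrow> ('y, 'n) cat \<Rightarrow> ('x \<times> 'y, 'm \<times> 'n) cat" where
  "prod_cat A B = \<lparr>Ob = Ob A \<times> Ob B,
     Hom = (\<lambda>(x, y) (x', y'). Hom A x x' \<times> Hom B y y'),
     Cmp = (\<lambda>(f, g) (f', g'). (Cmp A f f', Cmp B g g')),
     Idm = (\<lambda>(x, y). (Idm A x, Idm B y))\<rparr>"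


section \<open>Bicategories\<close>

text \<open>
  \<open>g \<star> f\<close> is composition of arrows, \<open>\<beta> \<ast> \<alpha>\<close> horizontal and \<open>\<beta> \<cdot> \<alpha>\<close> vertical composition of
  2-cells, all written in the order of function composition. The structure cells are
  \<open>\<a> h g f : (h \<star> g) \<star> f \<Rightarrow> h \<star> (g \<star> f)\<close>, \<open>\<l> f : \<one> (trg f) \<star> f \<Rightarrow> f\<close> and \<open>\<r> f : f \<star> \<one> (src f) \<Rightarrow> f\<close>.
\<close>

record ('o, 'a, 'c) bicat =
  Obj :: "'o set"
  Arr :: "'a set"
  Cell :: "'c set"
  src :: "'a \<Rightarrow> 'o"
  trg :: "'a \<Rightarrow> 'o"
  dom2 :: "'c \<Rightarrow> 'a"
  cod2 :: "'c \<Rightarrow> 'a"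
  id1 :: "'o \<Rightarrow> 'a"  ("\<one>\<index>")
  id2 :: "'a \<Rightarrow> 'c"  ("\<i>\<index>")
  comp1 :: "'a \<Rightarrow> 'a \<Rightarrow> 'a"  (infixr "\<star>\<index>" 75)
  hcomp :: "'c \<Rightarrow> 'c \<Rightarrow> 'c"  (infixr "\<ast>\<index>" 75)
  vcomp :: "'c \<Rightarrow> 'c \<Rightarrow> 'c"  (infixr "\<cdot>\<index>" 65)
  assoc :: "'a \<Rightarrow> 'a \<Rightarrow> 'a \<Rightarrow> 'c"  ("\<a>\<index>")
  lunit :: "'a \<Rightarrow> 'c"  ("\<l>\<index>")
  runit :: "'a \<Rightarrow> 'c"  ("\<r>\<index>")

locale bicategory_data =
  fixes C :: "('o, 'a, 'c, 'z) bicat_scheme" (structure)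
begin

definition arr :: "'o \<Rightarrow> 'o \<Rightarrow> 'a set" where
  "arr X Y = {f \<in> Arr C. src C f = X \<and> trg C f = Y}"

definition cell :: "'a \<Rightarrow> 'a \<Rightarrow> 'c set" where
  "cell f g = {\<alpha> \<in> Cell C. dom2 C \<alpha> = f \<and> cod2 C \<alpha> = g}"

definition inverse_cells :: "'c \<Rightarrow> 'c \<Rightarrow> bool" where
  "inverse_cells \<alpha> \<beta> \<longleftrightarrow> \<beta> \<in> cell (cod2 C \<alpha>) (dom2 C \<alpha>) \<and>
     \<beta> \<cdot> \<alpha> = \<i> (dom2 C \<alpha>) \<and> \<alpha> \<cdot> \<beta> = \<i> (cod2 C \<alpha>)"

definition icell :: "'a \<Rightarrow> 'a \<Rightarrow> 'c set" where
  "icell f g = {\<alpha> \<in> cell f g. \<exists>\<beta>. inverse_cells \<alpha> \<beta>}"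

text \<open>Meaningful only for invertible 2-cells, where the inverse is unique.\<close>

definition inv2 :: "'c \<Rightarrow> 'c" where
  "inv2 \<alpha> = (THE \<beta>. inverse_cells \<alpha> \<beta>)"

abbreviation whisker_left :: "'a \<Rightarrow> 'c \<Rightarrow> 'c"  (infixr "\<rhd>" 75) where
  "g \<rhd> \<alpha> \<equiv> \<i> g \<ast> \<alpha>"

abbreviation whisker_right :: "'c \<Rightarrow> 'a \<Rightarrow> 'c"  (infixr "\<lhd>" 75) where
  "\<alpha> \<lhd> f \<equiv> \<alpha> \<ast> \<i> f"

end

locale bicategory = bicategory_data C
  for C :: "('o, 'a, 'c, 'z) bicat_scheme" (structure) +
  assumes src_trg: "f \<in> Arr C \<Longrightarrow> src C f \<in> Obj C \<and> trg C f \<in> Obj C"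
    and dom_cod: "\<alpha> \<in> Cell C \<Longrightarrow> dom2 C \<alpha> \<in> Arr C \<and> cod2 C \<alpha> \<in> Arr C \<and>
      src C (dom2 C \<alpha>) = src C (cod2 C \<alpha>) \<and> trg C (dom2 C \<alpha>) = trg C (cod2 C \<alpha>)"
    and id2_cell: "f \<in> Arr C \<Longrightarrow> \<i> f \<in> cell f f"
    and vcomp_cell: "\<alpha> \<in> cell f g \<Longrightarrow> \<beta> \<in> cell g h \<Longrightarrow> \<beta> \<cdot> \<alpha> \<in> cell f h"
    and vcomp_assoc: "\<alpha> \<in> cell f g \<Longrightarrow> \<beta> \<in> cell g h \<Longrightarrow> \<gamma> \<in> cell h k \<Longrightarrow>
      (\<gamma> \<cdot> \<beta>) \<cdot> \<alpha> = \<gamma> \<cdot> (\<beta> \<cdot> \<alpha>)"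
    and vcomp_id2: "\<alpha> \<in> cell f g \<Longrightarrow> \<alpha> \<cdot> \<i> f = \<alpha> \<and> \<i> g \<cdot> \<alpha> = \<alpha>"
    and id1_arr: "X \<in> Obj C \<Longrightarrow> \<one> X \<in> arr X X"
    and comp1_arr: "f \<in> arr X Y \<Longrightarrow> g \<in> arr Y Z \<Longrightarrow> g \<star> f \<in> arr X Z"
    and hcomp_cell: "f \<in> arr X Y \<Longrightarrow> g \<in> arr Y Z \<Longrightarrow> \<alpha> \<in> cell f f' \<Longrightarrow> \<beta> \<in> cell g g' \<Longrightarrow>
      \<beta> \<ast> \<alpha> \<in> cell (g \<star> f) (g' \<star> f')"
    and hcomp_id2: "f \<in> arr X Y \<Longrightarrow> g \<in> arr Y Z \<Longrightarrow> \<i> g \<ast> \<i> f = \<i> (g \<star> f)"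
    and interchange: "f \<in> arr X Y \<Longrightarrow> g \<in> arr Y Z \<Longrightarrow>
      \<alpha> \<in> cell f f' \<Longrightarrow> \<alpha>' \<in> cell f' f'' \<Longrightarrow> \<beta> \<in> cell g g' \<Longrightarrow> \<beta>' \<in> cell g' g'' \<Longrightarrow>
      (\<beta>' \<cdot> \<beta>) \<ast> (\<alpha>' \<cdot> \<alpha>) = (\<beta>' \<ast> \<alpha>') \<cdot> (\<beta> \<ast> \<alpha>)"
    and assoc_icell: "f \<in> arr X Y \<Longrightarrow> g \<in> arr Y Z \<Longrightarrow> h \<in> arr Z V \<Longrightarrow>
      \<a> h g f \<in> icell ((h \<star> g) \<star> f) (h \<star> (g \<star> f))"
    and assoc_natural: "f \<in> arr X Y \<Longrightarrow> g \<in> arr Y Z \<Longrightarrow> h \<in> arr Z V \<Longrightarrow>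
      \<alpha> \<in> cell f f' \<Longrightarrow> \<beta> \<in> cell g g' \<Longrightarrow> \<gamma> \<in> cell h h' \<Longrightarrow>
      \<a> h' g' f' \<cdot> ((\<gamma> \<ast> \<beta>) \<ast> \<alpha>) = (\<gamma> \<ast> (\<beta> \<ast> \<alpha>)) \<cdot> \<a> h g f"
    and lunit_icell: "f \<in> arr X Y \<Longrightarrow> \<l> f \<in> icell (\<one> Y \<star> f) f"
    and lunit_natural: "f \<in> arr X Y \<Longrightarrow> \<alpha> \<in> cell f f' \<Longrightarrow> \<l> f' \<cdot> (\<one> Y \<rhd> \<alpha>) = \<alpha> \<cdot> \<l> f"
    and runit_icell: "f \<in> arr X Y \<Longrightarrow> \<r> f \<in> icell (f \<star> \<one> X) f"
    and runit_natural: "f \<in> arr X Y \<Longrightarrow> \<alpha> \<in> cell f f' \<Longrightarrow> \<r> f' \<cdot> (\<alpha> \<lhd> \<one> X) = \<alpha> \<cdot> \<r> f"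
    and pentagon: "f \<in> arr X Y \<Longrightarrow> g \<in> arr Y Z \<Longrightarrow> h \<in> arr Z V \<Longrightarrow> k \<in> arr V U \<Longrightarrow>
      (k \<rhd> \<a> h g f) \<cdot> \<a> k (h \<star> g) f \<cdot> (\<a> k h g \<lhd> f) = \<a> k h (g \<star> f) \<cdot> \<a> (k \<star> h) g f"
    and triangle: "f \<in> arr X Y \<Longrightarrow> g \<in> arr Y Z \<Longrightarrow>
      (g \<rhd> \<l> f) \<cdot> \<a> g (\<one> Y) f = \<r> g \<lhd> f"
begin

definition iso_arr :: "'a \<Rightarrow> 'a \<Rightarrow> bool"  (infix "\<cong>" 50) where
  "f \<cong> g \<longleftrightarrow> icell f g \<noteq> {}"

definition is_equivalence :: "'a \<Rightarrow> bool" where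
  "is_equivalence f \<longleftrightarrow> f \<in> Arr C \<and>
     (\<exists>g \<in> arr (trg C f) (src C f). g \<star> f \<cong> \<one> (src C f) \<and> f \<star> g \<cong> \<one> (trg C f))"

definition hom_cat :: "'o \<Rightarrow> 'o \<Rightarrow> ('a, 'c) cat" where
  "hom_cat X Y = \<lparr>Ob = arr X Y, Hom = cell, Cmp = (\<cdot>), Idm = \<i>\<rparr>"


subsection \<open>Bicategorical limits and colimits\<close>

definition biterminal :: "'o \<Rightarrow> bool" where
  "biterminal T \<longleftrightarrow> T \<in> Obj C \<and>
     (\<forall>X \<in> Obj C. is_cat_equivalence (hom_cat X T) terminal_cat to_terminal)"

definition biinitial :: "'o \<Rightarrow> bool" where
  "biinitial I \<longleftrightarrow> I \<in> Obj C \<and>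
     (\<forall>X \<in> Obj C. is_cat_equivalence (hom_cat I X) terminal_cat to_terminal)"

definition bicoproduct :: "'o \<Rightarrow> 'o \<Rightarrow> 'o \<Rightarrow> 'a \<Rightarrow> 'a \<Rightarrow> bool" where
  "bicoproduct X Y S i\<^sub>0 i\<^sub>1 \<longleftrightarrow> i\<^sub>0 \<in> arr X S \<and> i\<^sub>1 \<in> arr Y S \<and>
     (\<forall>T \<in> Obj C. is_cat_equivalence (hom_cat S T) (prod_cat (hom_cat X T) (hom_cat Y T))
        \<lparr>on_ob = (\<lambda>t. (t \<star> i\<^sub>0, t \<star> i\<^sub>1)), on_hom = (\<lambda>_ _ \<theta>. (\<theta> \<lhd> i\<^sub>0, \<theta> \<lhd> i\<^sub>1))\<rparr>)"

text \<open>
  Objects of \<open>cone_cat f g T\<close>, for \<open>f : B \<rightarrow> D\<close> and \<open>g : E \<rightarrow> D\<close>, are the squares \<open>(u, \<sigma>, v)\<close> with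
  \<open>u : T \<rightarrow> B\<close>, \<open>v : T \<rightarrow> E\<close> and \<open>\<sigma> : f \<star> u \<Rightarrow> g \<star> v\<close> invertible; dually for \<open>cocone_cat\<close>.
\<close>

definition cone_cat :: "'a \<Rightarrow> 'a \<Rightarrow> 'o \<Rightarrow> ('a \<times> 'c \<times> 'a, 'c \<times> 'c) cat" where
  "cone_cat f g T = \<lparr>
     Ob = {(u, \<sigma>, v). u \<in> arr T (src C f) \<and> v \<in> arr T (src C g) \<and> \<sigma> \<in> icell (f \<star> u) (g \<star> v)},
     Hom = (\<lambda>(u, \<sigma>, v) (u', \<sigma>', v').
       {(\<alpha>, \<beta>). \<alpha> \<in> cell u u' \<and> \<beta> \<in> cell v v' \<and> (g \<rhd> \<beta>) \<cdot> \<sigma> = \<sigma>' \<cdot> (f \<rhd> \<alpha>)}),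
     Cmp = (\<lambda>(\<alpha>, \<beta>) (\<alpha>', \<beta>'). (\<alpha> \<cdot> \<alpha>', \<beta> \<cdot> \<beta>')),
     Idm = (\<lambda>(u, \<sigma>, v). (\<i> u, \<i> v))\<rparr>"

definition cocone_cat :: "'a \<Rightarrow> 'a \<Rightarrow> 'o \<Rightarrow> ('a \<times> 'c \<times> 'a, 'c \<times> 'c) cat" where
  "cocone_cat f g T = \<lparr>
     Ob = {(u, \<sigma>, v). u \<in> arr (trg C f) T \<and> v \<in> arr (trg C g) T \<and> \<sigma> \<in> icell (u \<star> f) (v \<star> g)},
     Hom = (\<lambda>(u, \<sigma>, v) (u', \<sigma>', v').
       {(\<alpha>, \<beta>). \<alpha> \<in> cell u u' \<and> \<beta> \<in> cell v v' \<and> (\<beta> \<lhd> g) \<cdot> \<sigma> = \<sigma>' \<cdot> (\<alpha> \<lhd> f)}),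
     Cmp = (\<lambda>(\<alpha>, \<beta>) (\<alpha>', \<beta>'). (\<alpha> \<cdot> \<alpha>', \<beta> \<cdot> \<beta>')),
     Idm = (\<lambda>(u, \<sigma>, v). (\<i> u, \<i> v))\<rparr>"

text \<open>Functors out of a hom-category given by pasting a fixed square with an arrow.\<close>

definition paste_cone :: "'a \<Rightarrow> 'a \<Rightarrow> 'a \<Rightarrow> 'c \<Rightarrow> 'a \<Rightarrow> ('a, 'c, 'a \<times> 'c \<times> 'a, 'c \<times> 'c) ftor" where
  "paste_cone f g p \<phi> q = \<lparr>
     on_ob = (\<lambda>t. (p \<star> t, \<a> g q t \<cdot> (\<phi> \<lhd> t) \<cdot> inv2 (\<a> f p t), q \<star> t)),
     on_hom = (\<lambda>_ _ \<theta>. (p \<rhd> \<theta>, q \<rhd> \<theta>))\<rparr>"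

definition paste_cocone :: "'a \<Rightarrow> 'a \<Rightarrow> 'a \<Rightarrow> 'c \<Rightarrow> 'a \<Rightarrow> ('a, 'c, 'a \<times> 'c \<times> 'a, 'c \<times> 'c) ftor" where
  "paste_cocone f g i \<phi> j = \<lparr>
     on_ob = (\<lambda>t. (t \<star> i, inv2 (\<a> t j g) \<cdot> (t \<rhd> \<phi>) \<cdot> \<a> t i f, t \<star> j)),
     on_hom = (\<lambda>_ _ \<theta>. (\<theta> \<lhd> i, \<theta> \<lhd> j))\<rparr>"

definition biPullback :: "'a \<Rightarrow> 'a \<Rightarrow> 'o \<Rightarrow> 'a \<Rightarrow> 'c \<Rightarrow> 'a \<Rightarrow> bool" where
  "biPullback f g P p \<phi> q \<longleftrightarrow> f \<in> Arr C \<and> g \<in> Arr C \<and> trg C f = trg C g \<and> P \<in> Obj C \<and>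
     (p, \<phi>, q) \<in> Ob (cone_cat f g P) \<and>
     (\<forall>T \<in> Obj C. is_cat_equivalence (hom_cat T P) (cone_cat f g T) (paste_cone f g p \<phi> q))"

definition biPushout :: "'a \<Rightarrow> 'a \<Rightarrow> 'o \<Rightarrow> 'a \<Rightarrow> 'c \<Rightarrow> 'a \<Rightarrow> bool" where
  "biPushout f g Q i \<phi> j \<longleftrightarrow> f \<in> Arr C \<and> g \<in> Arr C \<and> src C f = src C g \<and> Q \<in> Obj C \<and>
     (i, \<phi>, j) \<in> Ob (cocone_cat f g Q) \<and>
     (\<forall>T \<in> Obj C. is_cat_equivalence (hom_cat Q T) (cocone_cat f g T) (paste_cocone f g i \<phi> j))"


subsection \<open>The lifting property\<close>

definition lifting_cat :: "'a \<Rightarrow> 'a \<Rightarrow> ('a \<times> 'c \<times> 'a, 'c \<times> 'c) cat" where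
  "lifting_cat i p = \<lparr>
     Ob = {(a, \<gamma>, b). a \<in> arr (src C i) (src C p) \<and> b \<in> arr (trg C i) (trg C p) \<and>
       \<gamma> \<in> icell (p \<star> a) (b \<star> i)},
     Hom = (\<lambda>(a, \<gamma>, b) (a', \<gamma>', b').
       {(\<alpha>, \<beta>). \<alpha> \<in> cell a a' \<and> \<beta> \<in> cell b b' \<and> (\<beta> \<lhd> i) \<cdot> \<gamma> = \<gamma>' \<cdot> (p \<rhd> \<alpha>)}),
     Cmp = (\<lambda>(\<alpha>, \<beta>) (\<alpha>', \<beta>'). (\<alpha> \<cdot> \<alpha>', \<beta> \<cdot> \<beta>')),
     Idm = (\<lambda>(a, \<gamma>, b). (\<i> a, \<i> b))\<rparr>"

definition lifting_ftor :: "'a \<Rightarrow> 'a \<Rightarrow> ('a, 'c, 'a \<times> 'c \<times> 'a, 'c \<times> 'c) ftor" where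
  "lifting_ftor i p = \<lparr>
     on_ob = (\<lambda>f. (f \<star> i, inv2 (\<a> p f i), p \<star> f)),
     on_hom = (\<lambda>_ _ \<theta>. (\<theta> \<lhd> i, p \<rhd> \<theta>))\<rparr>"

definition lifting_property :: "'a \<Rightarrow> 'a \<Rightarrow> bool" where
  "lifting_property i p \<longleftrightarrow>
     ess_surjective (hom_cat (trg C i) (src C p)) (lifting_cat i p) (lifting_ftor i p) \<and>
     ess_full (hom_cat (trg C i) (src C p)) (lifting_cat i p) (lifting_ftor i p)"

end


section \<open>Model bicategories\<close>

record ('o, 'a, 'c) model_bicat = "('o, 'a, 'c) bicat" +
  Fib :: "'a set"
  Cof :: "'a set"
  WE :: "'a set"

locale model_bicategory = bicategory C
  for C :: "('o, 'a, 'c, 'z) model_bicat_scheme" (structure) +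
  assumes classes: "Fib C \<subseteq> Arr C" "Cof C \<subseteq> Arr C" "WE C \<subseteq> Arr C"
    and M0_biterminal: "\<exists>T. biterminal T"
    and M0_biPullback: "f \<in> Arr C \<Longrightarrow> g \<in> Arr C \<Longrightarrow> trg C f = trg C g \<Longrightarrow>
      \<exists>P p \<phi> q. biPullback f g P p \<phi> q"
    and M0_biinitial: "\<exists>I. biinitial I"
    and M0_biPushout: "f \<in> Arr C \<Longrightarrow> g \<in> Arr C \<Longrightarrow> src C f = src C g \<Longrightarrow>
      \<exists>Q i \<phi> j. biPushout f g Q i \<phi> j"
    and M1: "i \<in> Cof C \<Longrightarrow> p \<in> Fib C \<Longrightarrow> i \<in> WE C \<or> p \<in> WE C \<Longrightarrow> lifting_property i p"
    and M2_cof_we: "f \<in> arr X Y \<Longrightarrow>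
      \<exists>Z i p. i \<in> arr X Z \<inter> Cof C \<inter> WE C \<and> p \<in> arr Z Y \<inter> Fib C \<and> f \<cong> p \<star> i"
    and M2_fib_we: "f \<in> arr X Y \<Longrightarrow>
      \<exists>Z i p. i \<in> arr X Z \<inter> Cof C \<and> p \<in> arr Z Y \<inter> Fib C \<inter> WE C \<and> f \<cong> p \<star> i"
    and M3_fib_comp: "f \<in> Fib C \<Longrightarrow> g \<in> Fib C \<Longrightarrow> trg C f = src C g \<Longrightarrow> g \<star> f \<in> Fib C"
    and M3_fib_biPullback: "biPullback f g P p \<phi> q \<Longrightarrow> f \<in> Fib C \<Longrightarrow> q \<in> Fib C"
    and M3_fib_equivalence: "is_equivalence f \<Longrightarrow> f \<in> Fib C"
    and M3_fib_iso: "f \<in> Fib C \<Longrightarrow> f \<cong> g \<Longrightarrow> g \<in> Fib C"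
    and M3_cof_comp: "f \<in> Cof C \<Longrightarrow> g \<in> Cof C \<Longrightarrow> trg C f = src C g \<Longrightarrow> g \<star> f \<in> Cof C"
    and M3_cof_biPushout: "biPushout f g Q i \<phi> j \<Longrightarrow> f \<in> Cof C \<Longrightarrow> j \<in> Cof C"
    and M3_cof_equivalence: "is_equivalence f \<Longrightarrow> f \<in> Cof C"
    and M3_cof_iso: "f \<in> Cof C \<Longrightarrow> f \<cong> g \<Longrightarrow> g \<in> Cof C"
    and M4_biPullback: "biPullback f g P p \<phi> q \<Longrightarrow> f \<in> Fib C \<inter> WE C \<Longrightarrow> q \<in> WE C"
    and M4_biPushout: "biPushout f g Q i \<phi> j \<Longrightarrow> f \<in> Cof C \<inter> WE C \<Longrightarrow> j \<in> WE C"
    and M5: "f \<in> arr X Y \<Longrightarrow> g \<in> arr Y Z \<Longrightarrow> g \<star> f \<cong> h \<Longrightarrow>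
      (f \<in> WE C \<and> g \<in> WE C \<longrightarrow> h \<in> WE C) \<and>
      (f \<in> WE C \<and> h \<in> WE C \<longrightarrow> g \<in> WE C) \<and>
      (g \<in> WE C \<and> h \<in> WE C \<longrightarrow> f \<in> WE C)"
    and M5_equivalence: "is_equivalence f \<Longrightarrow> f \<in> WE C"


section \<open>Cylinders, homotopies and the germ relation\<close>

text \<open>The arguments are \<open>W Z d\<^sub>0 d\<^sub>1 x s \<alpha>\<^sub>0 \<alpha>\<^sub>1\<close>.\<close>

datatype ('o, 'a, 'c) cylinder = Cyl 'o 'o 'a 'a 'a 'a 'c 'c

text \<open>The arguments are \<open>C h \<eta> \<epsilon>\<close> with \<open>C\<close> a cylinder.\<close>

datatype ('o, 'a, 'c) homotopy = Hpy "('o, 'a, 'c) cylinder" 'a 'c 'c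

text \<open>The arguments are \<open>k l \<gamma>\<^sub>0 \<gamma>\<^sub>1 \<mu> \<nu>\<close>.\<close>

datatype ('a, 'c) cylinder_mor = Mor 'a 'a 'c 'c 'c 'c

context model_bicategory
begin

fun w_cylinder :: "'o \<Rightarrow> ('o, 'a, 'c) cylinder \<Rightarrow> bool" where
  "w_cylinder X (Cyl W Z d\<^sub>0 d\<^sub>1 x s \<alpha>\<^sub>0 \<alpha>\<^sub>1) \<longleftrightarrow>
     d\<^sub>0 \<in> arr X W \<and> d\<^sub>1 \<in> arr X W \<and> x \<in> arr X Z \<and> s \<in> arr W Z \<inter> WE C \<and>
     \<alpha>\<^sub>0 \<in> icell (s \<star> d\<^sub>0) x \<and> \<alpha>\<^sub>1 \<in> icell (s \<star> d\<^sub>1) x"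

text \<open>
  The induced arrow \<open>u\<close> out of the bicoproduct of \<open>X\<close> with itself is determined only up to
  equivalence, and the class of cofibrations is stable under this change.
\<close>

fun q_cylinder :: "'o \<Rightarrow> ('o, 'a, 'c) cylinder \<Rightarrow> bool" where
  "q_cylinder X (Cyl W Z d\<^sub>0 d\<^sub>1 x s \<alpha>\<^sub>0 \<alpha>\<^sub>1) \<longleftrightarrow>
     w_cylinder X (Cyl W Z d\<^sub>0 d\<^sub>1 x s \<alpha>\<^sub>0 \<alpha>\<^sub>1) \<and> Z = X \<and> x = \<one> X \<and>
     (\<exists>S i\<^sub>0 i\<^sub>1 u. bicoproduct X X S i\<^sub>0 i\<^sub>1 \<and> u \<in> arr S W \<and> u \<star> i\<^sub>0 \<cong> d\<^sub>0 \<and> u \<star> i\<^sub>1 \<cong> d\<^sub>1 \<and>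
        u \<in> Cof C)"

fun left_w_homotopy :: "'o \<Rightarrow> 'o \<Rightarrow> 'a \<Rightarrow> 'a \<Rightarrow> ('o, 'a, 'c) homotopy \<Rightarrow> bool" where
  "left_w_homotopy X Y f g (Hpy (Cyl W Z d\<^sub>0 d\<^sub>1 x s \<alpha>\<^sub>0 \<alpha>\<^sub>1) h \<eta> \<epsilon>) \<longleftrightarrow>
     f \<in> arr X Y \<and> g \<in> arr X Y \<and> w_cylinder X (Cyl W Z d\<^sub>0 d\<^sub>1 x s \<alpha>\<^sub>0 \<alpha>\<^sub>1) \<and>
     h \<in> arr W Y \<and> \<eta> \<in> cell f (h \<star> d\<^sub>0) \<and> \<epsilon> \<in> cell (h \<star> d\<^sub>1) g"

fun left_q_homotopy :: "'o \<Rightarrow> 'o \<Rightarrow> 'a \<Rightarrow> 'a \<Rightarrow> ('o, 'a, 'c) homotopy \<Rightarrow> bool" where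
  "left_q_homotopy X Y f g (Hpy K h \<eta> \<epsilon>) \<longleftrightarrow>
     left_w_homotopy X Y f g (Hpy K h \<eta> \<epsilon>) \<and> q_cylinder X K"

fun fibrant :: "('o, 'a, 'c) homotopy \<Rightarrow> bool" where
  "fibrant (Hpy (Cyl W Z d\<^sub>0 d\<^sub>1 x s \<alpha>\<^sub>0 \<alpha>\<^sub>1) h \<eta> \<epsilon>) \<longleftrightarrow> s \<in> Fib C"

fun cylinder_morphism ::
  "('o, 'a, 'c) cylinder \<Rightarrow> ('o, 'a, 'c) cylinder \<Rightarrow> ('a, 'c) cylinder_mor \<Rightarrow> bool" where
  "cylinder_morphism (Cyl W Z d\<^sub>0 d\<^sub>1 x s \<alpha>\<^sub>0 \<alpha>\<^sub>1) (Cyl W' Z' d\<^sub>0' d\<^sub>1' x' s' \<alpha>\<^sub>0' \<alpha>\<^sub>1')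
     (Mor k l \<gamma>\<^sub>0 \<gamma>\<^sub>1 \<mu> \<nu>) \<longleftrightarrow>
     k \<in> arr W W' \<and> l \<in> arr Z Z' \<and>
     \<gamma>\<^sub>0 \<in> icell d\<^sub>0' (k \<star> d\<^sub>0) \<and> \<gamma>\<^sub>1 \<in> icell d\<^sub>1' (k \<star> d\<^sub>1) \<and>
     \<mu> \<in> icell (s' \<star> k) (l \<star> s) \<and> \<nu> \<in> icell x' (l \<star> x) \<and>
     (l \<rhd> \<alpha>\<^sub>0) \<cdot> \<a> l s d\<^sub>0 \<cdot> (\<mu> \<lhd> d\<^sub>0) \<cdot> inv2 (\<a> s' k d\<^sub>0) \<cdot> (s' \<rhd> \<gamma>\<^sub>0) = \<nu> \<cdot> \<alpha>\<^sub>0' \<and>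
     (l \<rhd> \<alpha>\<^sub>1) \<cdot> \<a> l s d\<^sub>1 \<cdot> (\<mu> \<lhd> d\<^sub>1) \<cdot> inv2 (\<a> s' k d\<^sub>1) \<cdot> (s' \<rhd> \<gamma>\<^sub>1) = \<nu> \<cdot> \<alpha>\<^sub>1'"

fun germ_square ::
  "('o, 'a, 'c) homotopy \<Rightarrow> ('o, 'a, 'c) homotopy \<Rightarrow> ('a, 'c) cylinder_mor \<Rightarrow> 'c \<Rightarrow> bool" where
  "germ_square (Hpy (Cyl W Z d\<^sub>0 d\<^sub>1 x s \<alpha>\<^sub>0 \<alpha>\<^sub>1) h \<eta> \<epsilon>)
     (Hpy (Cyl W' Z' d\<^sub>0' d\<^sub>1' x' s' \<alpha>\<^sub>0' \<alpha>\<^sub>1') h' \<eta>' \<epsilon>') (Mor k l \<gamma>\<^sub>0 \<gamma>\<^sub>1 \<mu> \<nu>) \<rho> \<longleftrightarrow>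
     cylinder_morphism (Cyl W Z d\<^sub>0 d\<^sub>1 x s \<alpha>\<^sub>0 \<alpha>\<^sub>1) (Cyl W' Z' d\<^sub>0' d\<^sub>1' x' s' \<alpha>\<^sub>0' \<alpha>\<^sub>1')
       (Mor k l \<gamma>\<^sub>0 \<gamma>\<^sub>1 \<mu> \<nu>) \<and>
     \<rho> \<in> icell (h' \<star> k) h \<and>
     \<eta> = (\<rho> \<lhd> d\<^sub>0) \<cdot> inv2 (\<a> h' k d\<^sub>0) \<cdot> (h' \<rhd> \<gamma>\<^sub>0) \<cdot> \<eta>' \<and>
     \<epsilon> = \<epsilon>' \<cdot> (h' \<rhd> inv2 \<gamma>\<^sub>1) \<cdot> \<a> h' k d\<^sub>1 \<cdot> (inv2 \<rho> \<lhd> d\<^sub>1)"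

definition germ_related ::
  "'o \<Rightarrow> 'o \<Rightarrow> 'a \<Rightarrow> 'a \<Rightarrow> ('o, 'a, 'c) homotopy \<Rightarrow> ('o, 'a, 'c) homotopy \<Rightarrow> bool" where
  "germ_related X Y f g H\<^sub>1 H\<^sub>2 \<longleftrightarrow>
     left_w_homotopy X Y f g H\<^sub>1 \<and> left_w_homotopy X Y f g H\<^sub>2 \<and> (\<exists>M \<rho>. germ_square H\<^sub>1 H\<^sub>2 M \<rho>)"

end

end

theory Submission
  imports Defs
begin

text \<open>
  Write \<open>H = (C, h, \<eta>, \<epsilon>)\<close> with \<open>C = (W, Z, d\<^sub>0, d\<^sub>1, x, s, \<alpha>\<^sub>0, \<alpha>\<^sub>1)\<close>. Pull the trivial fibration \<open>s\<close>
  back along \<open>x\<close>, obtaining a trivial fibration \<open>q : P \<rightarrow> X\<close> and \<open>p : P \<rightarrow> W\<close>. The cells \<open>\<alpha>\<^sub>j\<close> present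
  \<open>(d\<^sub>j, id)\<close> as cones, hence there are sections \<open>e\<^sub>j\<close> of \<open>q\<close> with \<open>p \<star> e\<^sub>j \<cong> d\<^sub>j\<close>. Factor the arrow
  \<open>X \<amalg> X \<rightarrow> P\<close> induced by \<open>e\<^sub>0, e\<^sub>1\<close> into a cofibration followed by a trivial fibration \<open>m\<close>. The middle
  object is a \<open>q\<close>-cylinder over \<open>X\<close> with projection the trivial fibration \<open>q \<star> m\<close>, and \<open>(p \<star> m, x)\<close>
  is a morphism from it to \<open>C\<close>, along which \<open>H\<close> is restricted.
\<close>

section \<open>Calculus of 2-cells\<close>

context bicategory
begin

section \<open>Typing of arrows and 2-cells by source, target, domain and codomain\<close>

lemma comp1_simps:
  assumes "f \<in> Arr C" "g \<in> Arr C" "src C g = trg C f"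
  shows "g \<star> f \<in> Arr C" "src C (g \<star> f) = src C f" "trg C (g \<star> f) = trg C g"
  using comp1_arr[of f "src C f" "trg C f" g "trg C g"] assms by (auto simp: arr_def)

lemma id1_simps:
  assumes "X \<in> Obj C"
  shows "\<one> X \<in> Arr C" "src C (\<one> X) = X" "trg C (\<one> X) = X"
  using id1_arr[OF assms] by (auto simp: arr_def)

lemma id2_simps:
  assumes "f \<in> Arr C"
  shows "\<i> f \<in> Cell C" "dom2 C (\<i> f) = f" "cod2 C (\<i> f) = f"
  using id2_cell[OF assms] by (auto simp: cell_def)

lemma vcomp_simps:
  assumes "\<alpha> \<in> Cell C" "\<beta> \<in> Cell C" "cod2 C \<alpha> = dom2 C \<beta>"
  shows "\<beta> \<cdot> \<alpha> \<in> Cell C" "dom2 C (\<beta> \<cdot> \<alpha>) = dom2 C \<alpha>" "cod2 C (\<beta> \<cdot> \<alpha>) = cod2 C \<beta>"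
  using vcomp_cell[of \<alpha> "dom2 C \<alpha>" "dom2 C \<beta>" \<beta> "cod2 C \<beta>"] assms by (auto simp: cell_def)

lemma hcomp_simps:
  assumes "\<alpha> \<in> Cell C" "\<beta> \<in> Cell C" "src C (dom2 C \<beta>) = trg C (dom2 C \<alpha>)"
  shows "\<beta> \<ast> \<alpha> \<in> Cell C" "dom2 C (\<beta> \<ast> \<alpha>) = dom2 C \<beta> \<star> dom2 C \<alpha>"
    "cod2 C (\<beta> \<ast> \<alpha>) = cod2 C \<beta> \<star> cod2 C \<alpha>"
  using hcomp_cell[of "dom2 C \<alpha>" "src C (dom2 C \<alpha>)" "trg C (dom2 C \<alpha>)" "dom2 C \<beta>"
      "trg C (dom2 C \<beta>)" \<alpha> "cod2 C \<alpha>" \<beta> "cod2 C \<beta>"] dom_cod assms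
  by (auto simp: cell_def arr_def)

lemma vassoc:
  assumes "\<alpha> \<in> Cell C" "\<beta> \<in> Cell C" "\<gamma> \<in> Cell C" "cod2 C \<alpha> = dom2 C \<beta>" "cod2 C \<beta> = dom2 C \<gamma>"
  shows "(\<gamma> \<cdot> \<beta>) \<cdot> \<alpha> = \<gamma> \<cdot> (\<beta> \<cdot> \<alpha>)"
  using vcomp_assoc assms by (auto simp: cell_def)

lemma vunit:
  assumes "\<alpha> \<in> Cell C"
  shows "dom2 C \<alpha> = f \<Longrightarrow> \<alpha> \<cdot> \<i> f = \<alpha>" "cod2 C \<alpha> = g \<Longrightarrow> \<i> g \<cdot> \<alpha> = \<alpha>"
  using vcomp_id2 assms by (auto simp: cell_def)

text \<open>Unlike in \<open>icell\<close>, invertibility is separated from the boundary, so that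
  domains and codomains can be computed by rewriting \<open>dom2\<close> and
  \<open>cod2\<close>.\<close>

definition iso2 :: "'c \<Rightarrow> bool" where
  "iso2 \<alpha> \<longleftrightarrow> \<alpha> \<in> Cell C \<and> (\<exists>\<beta>. inverse_cells \<alpha> \<beta>)"

lemma icell_iff: "\<alpha> \<in> icell f g \<longleftrightarrow> iso2 \<alpha> \<and> dom2 C \<alpha> = f \<and> cod2 C \<alpha> = g"
  by (auto simp: icell_def iso2_def cell_def)

lemma iso2_Cell: "iso2 \<alpha> \<Longrightarrow> \<alpha> \<in> Cell C"
  by (simp add: iso2_def)

lemma inverse_cells_unique:
  assumes "\<alpha> \<in> Cell C" "inverse_cells \<alpha> \<beta>" "inverse_cells \<alpha> \<beta>'"
  shows "\<beta> = \<beta>'"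
proof -
  have "\<beta> = \<beta> \<cdot> (\<alpha> \<cdot> \<beta>')"
    using assms by (simp add: inverse_cells_def cell_def vunit)
  also have "\<dots> = (\<beta> \<cdot> \<alpha>) \<cdot> \<beta>'"
    using assms by (intro vassoc[symmetric]) (auto simp: inverse_cells_def cell_def)
  also have "\<dots> = \<beta>'"
    using assms by (simp add: inverse_cells_def cell_def vunit)
  finally show ?thesis .
qed

lemma inv2_eqI:
  assumes "\<alpha> \<in> Cell C" "inverse_cells \<alpha> \<beta>"
  shows "inv2 \<alpha> = \<beta>"
  unfolding inv2_def using assms inverse_cells_unique by blast

lemma inverse_cells_inv2: "iso2 \<alpha> \<Longrightarrow> inverse_cells \<alpha> (inv2 \<alpha>)"
  using inv2_eqI by (auto simp: iso2_def)

lemma inv2_simps: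
  assumes "iso2 \<alpha>"
  shows "inv2 \<alpha> \<in> Cell C" "dom2 C (inv2 \<alpha>) = cod2 C \<alpha>" "cod2 C (inv2 \<alpha>) = dom2 C \<alpha>"
    "inv2 \<alpha> \<cdot> \<alpha> = \<i> (dom2 C \<alpha>)" "\<alpha> \<cdot> inv2 \<alpha> = \<i> (cod2 C \<alpha>)" "iso2 (inv2 \<alpha>)" "inv2 (inv2 \<alpha>) = \<alpha>"
proof -
  note * = inverse_cells_inv2[OF assms] iso2_Cell[OF assms]
  then show 1: "inv2 \<alpha> \<in> Cell C" "dom2 C (inv2 \<alpha>) = cod2 C \<alpha>" "cod2 C (inv2 \<alpha>) = dom2 C \<alpha>"
    "inv2 \<alpha> \<cdot> \<alpha> = \<i> (dom2 C \<alpha>)" "\<alpha> \<cdot> inv2 \<alpha> = \<i> (cod2 C \<alpha>)"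
    by (auto simp: inverse_cells_def cell_def)
  then have 2: "inverse_cells (inv2 \<alpha>) \<alpha>"
    using * by (simp add: inverse_cells_def cell_def)
  with 1 show "iso2 (inv2 \<alpha>)" "inv2 (inv2 \<alpha>) = \<alpha>"
    by (auto simp: iso2_def inv2_eqI)
qed

text \<open>Since \<open>\<cdot>\<close> associates to the right, an adjacent inverse pair at the
  head of a longer composite is not a subterm; these forms cancel it there.\<close>

lemma inv2_cancel:
  assumes "iso2 \<alpha>" "\<beta> \<in> Cell C"
  shows "cod2 C \<beta> = dom2 C \<alpha> \<Longrightarrow> inv2 \<alpha> \<cdot> \<alpha> \<cdot> \<beta> = \<beta>"
    and "cod2 C \<beta> = cod2 C \<alpha> \<Longrightarrow> \<alpha> \<cdot> inv2 \<alpha> \<cdot> \<beta> = \<beta>"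
  using assms by (simp_all add: vassoc[symmetric] iso2_Cell inv2_simps vunit)

lemma iso2_id2: "f \<in> Arr C \<Longrightarrow> iso2 (\<i> f)"
  unfolding iso2_def inverse_cells_def cell_def
  by (auto simp: id2_simps vunit intro!: exI[of _ "\<i> f"])

lemma iso2_vcomp:
  assumes "iso2 \<alpha>" "iso2 \<beta>" "cod2 C \<alpha> = dom2 C \<beta>"
  shows "iso2 (\<beta> \<cdot> \<alpha>)"
proof -
  have "inverse_cells (\<beta> \<cdot> \<alpha>) (inv2 \<alpha> \<cdot> inv2 \<beta>)"
    using assms
    by (simp add: inverse_cells_def cell_def vassoc vcomp_simps iso2_Cell inv2_simps inv2_cancel)
  then show ?thesis
    using assms by (auto simp: iso2_def vcomp_simps)
qed

lemma hcomp_vcomp: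
  assumes "\<alpha> \<in> Cell C" "\<alpha>' \<in> Cell C" "\<beta> \<in> Cell C" "\<beta>' \<in> Cell C" "cod2 C \<alpha> = dom2 C \<alpha>'"
    "cod2 C \<beta> = dom2 C \<beta>'" "src C (dom2 C \<beta>) = trg C (dom2 C \<alpha>)"
  shows "(\<beta>' \<ast> \<alpha>') \<cdot> (\<beta> \<ast> \<alpha>) = (\<beta>' \<cdot> \<beta>) \<ast> (\<alpha>' \<cdot> \<alpha>)"
  using interchange[of "dom2 C \<alpha>" "src C (dom2 C \<alpha>)" "trg C (dom2 C \<alpha>)" "dom2 C \<beta>"
      "trg C (dom2 C \<beta>)" \<alpha> "dom2 C \<alpha>'" \<alpha>' "cod2 C \<alpha>'" \<beta> "dom2 C \<beta>'" \<beta>' "cod2 C \<beta>'"] dom_cod assms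
  by (auto simp: cell_def arr_def)

lemma id2_hcomp_id2:
  assumes "f \<in> Arr C" "g \<in> Arr C" "src C g = trg C f"
  shows "\<i> g \<ast> \<i> f = \<i> (g \<star> f)"
  using hcomp_id2 assms by (auto simp: arr_def)

lemma iso2_hcomp:
  assumes "iso2 \<alpha>" "iso2 \<beta>" "src C (dom2 C \<beta>) = trg C (dom2 C \<alpha>)"
  shows "iso2 (\<beta> \<ast> \<alpha>)" "inv2 (\<beta> \<ast> \<alpha>) = inv2 \<beta> \<ast> inv2 \<alpha>"
proof -
  have "\<alpha> \<in> Cell C" "\<beta> \<in> Cell C"
    using assms by (auto simp: iso2_Cell)
  then have "inverse_cells (\<beta> \<ast> \<alpha>) (inv2 \<beta> \<ast> inv2 \<alpha>)"
    using assms dom_cod[of \<alpha>] dom_cod[of \<beta>]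
    by (simp add: inverse_cells_def cell_def hcomp_vcomp hcomp_simps inv2_simps id2_hcomp_id2)
  then show "iso2 (\<beta> \<ast> \<alpha>)" "inv2 (\<beta> \<ast> \<alpha>) = inv2 \<beta> \<ast> inv2 \<alpha>"
    using assms by (auto simp: iso2_def hcomp_simps inv2_eqI)
qed

lemma assoc_simps:
  assumes "f \<in> Arr C" "g \<in> Arr C" "h \<in> Arr C" "src C g = trg C f" "src C h = trg C g"
  shows "iso2 (\<a> h g f)" "\<a> h g f \<in> Cell C" "dom2 C (\<a> h g f) = (h \<star> g) \<star> f"
    "cod2 C (\<a> h g f) = h \<star> (g \<star> f)"
  using assoc_icell[of f "src C f" "trg C f" g "trg C g" h "trg C h"] assms
  by (auto simp: arr_def icell_iff iso2_Cell)

lemma runit_simps: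
  assumes "f \<in> Arr C" "X = src C f"
  shows "iso2 (\<r> f)" "\<r> f \<in> Cell C" "dom2 C (\<r> f) = f \<star> \<one> X" "cod2 C (\<r> f) = f"
  using runit_icell[of f "src C f" "trg C f"] assms
  by (auto simp: arr_def icell_iff iso2_Cell)

lemmas inv2_vcomp = inv2_simps(4,5)

text \<open>Collects boundary computations and invertibility. The cancellation laws
  \<open>inv2_vcomp\<close> are kept apart, to be added where a composite is to collapse.\<close>

lemmas cell_simps = comp1_simps id1_simps id2_simps vcomp_simps hcomp_simps inv2_simps(1-3,6,7)
  assoc_simps runit_simps iso2_Cell iso2_id2 iso2_vcomp iso2_hcomp

section \<open>Isomorphism of arrows\<close>

lemma iso_arr_iff: "f \<cong> g \<longleftrightarrow> (\<exists>\<alpha>. iso2 \<alpha> \<and> dom2 C \<alpha> = f \<and> cod2 C \<alpha> = g)"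
  by (auto simp: iso_arr_def icell_iff)

lemma iso_arr_refl: "f \<in> Arr C \<Longrightarrow> f \<cong> f"
  unfolding iso_arr_iff using iso2_id2[of f] id2_simps[of f] by blast

lemma iso_arr_sym: "f \<cong> g \<Longrightarrow> g \<cong> f"
  unfolding iso_arr_iff using inv2_simps by metis

lemma iso_arr_trans: "f \<cong> g \<Longrightarrow> g \<cong> h \<Longrightarrow> f \<cong> h"
  unfolding iso_arr_iff using iso2_vcomp vcomp_simps iso2_Cell by metis

lemma iso_arr_whisker_right:
  assumes "g \<cong> g'" "f \<in> arr X Y" "g \<in> arr Y Z"
  shows "g \<star> f \<cong> g' \<star> f"
proof -
  obtain \<alpha> where "iso2 \<alpha>" "dom2 C \<alpha> = g" "cod2 C \<alpha> = g'"
    using assms(1) by (auto simp: iso_arr_iff)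
  then show ?thesis
    unfolding iso_arr_iff using assms(2,3)
    by (intro exI[of _ "\<alpha> \<lhd> f"]) (simp add: arr_def cell_simps)
qed

lemma iso_arr_assoc:
  assumes "f \<in> arr X Y" "g \<in> arr Y Z" "h \<in> arr Z V"
  shows "(h \<star> g) \<star> f \<cong> h \<star> (g \<star> f)"
  using assoc_icell[OF assms] by (auto simp: iso_arr_def)

text \<open>Invertible 2-cells are monic; an equation containing an inverse associator can thus be
  checked after composing with that associator.\<close>

lemma vcomp_cancel_left:
  assumes "iso2 \<gamma>" "\<alpha> \<in> Cell C" "\<beta> \<in> Cell C" "cod2 C \<alpha> = dom2 C \<gamma>" "cod2 C \<beta> = dom2 C \<gamma>"
    "\<gamma> \<cdot> \<alpha> = \<gamma> \<cdot> \<beta>"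
  shows "\<alpha> = \<beta>"
  using assms inv2_cancel(1) by metis


section \<open>Pasting a square with an arrow\<close>

text \<open>The 2-cell of the cone \<open>paste_cone f g p \<phi> q\<close> at \<open>t\<close>. A
  separate name lets pasting be iterated; the same cell later serves as \<open>\<mu>\<close> in the
  cylinder morphism.\<close>

definition paste :: "'a \<Rightarrow> 'a \<Rightarrow> 'a \<Rightarrow> 'c \<Rightarrow> 'a \<Rightarrow> 'a \<Rightarrow> 'c" where
  "paste f g p \<phi> q t = \<a> g q t \<cdot> (\<phi> \<lhd> t) \<cdot> inv2 (\<a> f p t)"

lemma paste_icell:
  assumes "\<phi> \<in> icell (f \<star> p) (g \<star> q)" "p \<in> arr P B" "q \<in> arr P E" "f \<in> arr B D" "g \<in> arr E D"
    "t \<in> arr T P"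
  shows "paste f g p \<phi> q t \<in> icell (f \<star> (p \<star> t)) (g \<star> (q \<star> t))"
  using assms unfolding paste_def icell_iff arr_def by (simp add: cell_simps)

text \<open>Combines naturality of both associators with interchange of \<open>\<phi>\<close> and
  \<open>\<theta>\<close>; it allows \<open>\<theta>\<close> to be moved across the pasted
  square.\<close>

lemma paste_natural:
  assumes \<phi>: "\<phi> \<in> icell (f \<star> p) (g \<star> q)" and p: "p \<in> arr P B" and q: "q \<in> arr P E"
    and f: "f \<in> arr B D" and g: "g \<in> arr E D"
    and t: "t \<in> arr T P" and t': "t' \<in> arr T P" and \<theta>: "\<theta> \<in> cell t t'"
  shows "(g \<rhd> q \<rhd> \<theta>) \<cdot> paste f g p \<phi> q t = paste f g p \<phi> q t' \<cdot> (f \<rhd> p \<rhd> \<theta>)"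
proof -
  note ty = \<phi>[unfolded icell_iff] p[unfolded arr_def] q[unfolded arr_def] f[unfolded arr_def]
    g[unfolded arr_def] t[unfolded arr_def] t'[unfolded arr_def] \<theta>[unfolded cell_def]
  have 1: "\<a> g q t' \<cdot> ((g \<star> q) \<rhd> \<theta>) = (g \<rhd> q \<rhd> \<theta>) \<cdot> \<a> g q t"
    using assoc_natural[OF t q g \<theta> id2_cell id2_cell] ty by (simp add: id2_hcomp_id2)
  have 2: "\<a> f p t' \<cdot> ((f \<star> p) \<rhd> \<theta>) = (f \<rhd> p \<rhd> \<theta>) \<cdot> \<a> f p t"
    using assoc_natural[OF t p f \<theta> id2_cell id2_cell] ty by (simp add: id2_hcomp_id2)
  have 3: "((g \<star> q) \<rhd> \<theta>) \<cdot> (\<phi> \<lhd> t) = (\<phi> \<lhd> t') \<cdot> ((f \<star> p) \<rhd> \<theta>)"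
    using ty by (simp add: hcomp_vcomp cell_simps vunit)
  \<comment> \<open>Naturality of the inverse associator, deduced from 2 by composing with the
    invertible \<open>\<a> f p t'\<close>.\<close>
  have 4: "((f \<star> p) \<rhd> \<theta>) \<cdot> inv2 (\<a> f p t) = inv2 (\<a> f p t') \<cdot> (f \<rhd> p \<rhd> \<theta>)"
  proof (rule vcomp_cancel_left[of "\<a> f p t'"])
    show "\<a> f p t' \<cdot> ((f \<star> p) \<rhd> \<theta>) \<cdot> inv2 (\<a> f p t)
      = \<a> f p t' \<cdot> inv2 (\<a> f p t') \<cdot> (f \<rhd> p \<rhd> \<theta>)"
      using ty by (simp add: vassoc[symmetric] cell_simps 2)
        (simp add: vassoc cell_simps inv2_vcomp vunit)
  qed (use ty in \<open>simp_all add: cell_simps\<close>)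
  have "(g \<rhd> q \<rhd> \<theta>) \<cdot> paste f g p \<phi> q t
    = ((g \<rhd> q \<rhd> \<theta>) \<cdot> \<a> g q t) \<cdot> (\<phi> \<lhd> t) \<cdot> inv2 (\<a> f p t)"
    using ty unfolding paste_def by (simp add: vassoc cell_simps)
  also have "\<dots> = \<a> g q t' \<cdot> (((g \<star> q) \<rhd> \<theta>) \<cdot> (\<phi> \<lhd> t)) \<cdot> inv2 (\<a> f p t)"
    using ty unfolding 1[symmetric] by (simp add: vassoc cell_simps)
  also have "\<dots> = \<a> g q t' \<cdot> (\<phi> \<lhd> t') \<cdot> (((f \<star> p) \<rhd> \<theta>) \<cdot> inv2 (\<a> f p t))"
    using ty unfolding 3 by (simp add: vassoc cell_simps)
  also have "\<dots> = paste f g p \<phi> q t' \<cdot> (f \<rhd> p \<rhd> \<theta>)"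
    using ty unfolding 4 paste_def by (simp add: vassoc cell_simps)
  finally show ?thesis .
qed

text \<open>One pentagon handles \<open>g, q, m, n\<close>, another, in inverted form, handles
  \<open>f, p, m, n\<close>; naturality of the associator at \<open>\<phi>\<close> joins the
  two.\<close>

lemma paste_paste:
  assumes \<phi>: "\<phi> \<in> icell (f \<star> p) (g \<star> q)" and p: "p \<in> arr P B" and q: "q \<in> arr P E"
    and f: "f \<in> arr B D" and g: "g \<in> arr E D"
    and m: "m \<in> arr V P" and n: "n \<in> arr T V"
  shows "(g \<rhd> \<a> q m n) \<cdot> paste f g (p \<star> m) (paste f g p \<phi> q m) (q \<star> m) n
    = paste f g p \<phi> q (m \<star> n) \<cdot> (f \<rhd> \<a> p m n)"
proof -
  note ty = \<phi>[unfolded icell_iff] p[unfolded arr_def] q[unfolded arr_def] f[unfolded arr_def]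
    g[unfolded arr_def] m[unfolded arr_def] n[unfolded arr_def]
  have expand: "paste f g p \<phi> q m \<lhd> n
    = (\<a> g q m \<lhd> n) \<cdot> ((\<phi> \<lhd> m) \<lhd> n) \<cdot> (inv2 (\<a> f p m) \<lhd> n)"
    using ty unfolding paste_def by (simp add: hcomp_vcomp cell_simps vunit)
  have 1: "(g \<rhd> \<a> q m n) \<cdot> \<a> g (q \<star> m) n \<cdot> (\<a> g q m \<lhd> n) = \<a> g q (m \<star> n) \<cdot> \<a> (g \<star> q) m n"
    by (rule pentagon[OF n m q g])
  have 2: "\<a> (g \<star> q) m n \<cdot> ((\<phi> \<lhd> m) \<lhd> n) = (\<phi> \<lhd> (m \<star> n)) \<cdot> \<a> (f \<star> p) m n"
    using assoc_natural[OF n m comp1_arr[OF p f] id2_cell id2_cell, of \<phi> "g \<star> q"] ty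
    by (simp add: id2_hcomp_id2 cell_def cell_simps)
  \<comment> \<open>The second pentagon solved for its inverse cells: after composing with
    \<open>\<a> f p (m \<star> n)\<close> the inverses cancel in turn.\<close>
  have 3: "\<a> (f \<star> p) m n \<cdot> (inv2 (\<a> f p m) \<lhd> n) \<cdot> inv2 (\<a> f (p \<star> m) n)
    = inv2 (\<a> f p (m \<star> n)) \<cdot> (f \<rhd> \<a> p m n)"
  proof (rule vcomp_cancel_left[of "\<a> f p (m \<star> n)"])
    let ?b = "inv2 (\<a> f p m) \<lhd> n" and ?c = "inv2 (\<a> f (p \<star> m) n)"
    have "\<a> f p (m \<star> n) \<cdot> \<a> (f \<star> p) m n \<cdot> ?b \<cdot> ?c
      = (\<a> f p (m \<star> n) \<cdot> \<a> (f \<star> p) m n) \<cdot> ?b \<cdot> ?c"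
      using ty by (simp add: vassoc cell_simps)
    also have "\<dots> = (f \<rhd> \<a> p m n) \<cdot> \<a> f (p \<star> m) n \<cdot> ((\<a> f p m \<lhd> n) \<cdot> ?b) \<cdot> ?c"
      using ty unfolding pentagon[OF n m p f, symmetric] by (simp add: vassoc cell_simps)
    also have "(\<a> f p m \<lhd> n) \<cdot> ?b = \<i> ((f \<star> p \<star> m) \<star> n)"
      using ty by (simp add: hcomp_vcomp cell_simps vunit inv2_vcomp id2_hcomp_id2)
    also have "(f \<rhd> \<a> p m n) \<cdot> \<a> f (p \<star> m) n \<cdot> \<i> ((f \<star> p \<star> m) \<star> n) \<cdot> ?c = f \<rhd> \<a> p m n"
      using ty by (simp add: cell_simps vunit inv2_vcomp)
    also have "\<dots> = \<a> f p (m \<star> n) \<cdot> inv2 (\<a> f p (m \<star> n)) \<cdot> (f \<rhd> \<a> p m n)"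
      using ty by (simp add: cell_simps inv2_cancel)
    finally show "\<a> f p (m \<star> n) \<cdot> \<a> (f \<star> p) m n \<cdot> ?b \<cdot> ?c
      = \<a> f p (m \<star> n) \<cdot> inv2 (\<a> f p (m \<star> n)) \<cdot> (f \<rhd> \<a> p m n)" .
  qed (use ty in \<open>simp_all add: cell_simps\<close>)
  have "(g \<rhd> \<a> q m n) \<cdot> paste f g (p \<star> m) (paste f g p \<phi> q m) (q \<star> m) n
    = ((g \<rhd> \<a> q m n) \<cdot> \<a> g (q \<star> m) n \<cdot> (\<a> g q m \<lhd> n)) \<cdot> ((\<phi> \<lhd> m) \<lhd> n) \<cdot>
      (inv2 (\<a> f p m) \<lhd> n) \<cdot> inv2 (\<a> f (p \<star> m) n)"
    using ty unfolding paste_def[of f g "p \<star> m"] expand by (simp add: vassoc cell_simps)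
  also have "\<dots> = \<a> g q (m \<star> n) \<cdot> (\<a> (g \<star> q) m n \<cdot> ((\<phi> \<lhd> m) \<lhd> n)) \<cdot>
      (inv2 (\<a> f p m) \<lhd> n) \<cdot> inv2 (\<a> f (p \<star> m) n)"
    using ty unfolding 1 by (simp add: vassoc cell_simps)
  also have "\<dots> = \<a> g q (m \<star> n) \<cdot> (\<phi> \<lhd> (m \<star> n)) \<cdot> (\<a> (f \<star> p) m n \<cdot>
      (inv2 (\<a> f p m) \<lhd> n) \<cdot> inv2 (\<a> f (p \<star> m) n))"
    using ty unfolding 2 by (simp add: vassoc cell_simps)
  also have "\<dots> = paste f g p \<phi> q (m \<star> n) \<cdot> (f \<rhd> \<a> p m n)"
    using ty unfolding 3 paste_def by (simp add: vassoc cell_simps)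
  finally show ?thesis .
qed


section \<open>Bicoproducts, and lifts along biPullbacks\<close>

text \<open>The equivalence with the terminal category gives each arrow \<open>a\<close> from
  \<open>I\<close> to \<open>T\<close> an isomorphism \<open>\<tau> a\<close> from the single arrow
  \<open>on_ob G ()\<close>. Naturality forces every cell from \<open>a\<close> to \<open>b\<close>
  to be \<open>\<tau> b \<cdot> inv2 (\<tau> a)\<close>.\<close>

lemma biinitial_cell_unique:
  assumes "biinitial I" "T \<in> Obj C" "a \<in> arr I T" "b \<in> arr I T"
  shows "\<exists>\<sigma> \<in> icell a b. \<forall>\<theta> \<in> cell a b. \<theta> = \<sigma>"
proof -
  obtain G \<tau> where G: "is_functor terminal_cat (hom_cat I T) G"
    and iso: "\<forall>a \<in> arr I T. cat_iso (hom_cat I T) (on_ob G ()) a (\<tau> a)"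
    and nat: "\<forall>a \<in> arr I T. \<forall>b \<in> arr I T. \<forall>\<theta> \<in> cell a b.
      \<tau> b \<cdot> on_hom G () () () = \<theta> \<cdot> \<tau> a"
    using assms(1,2)
    unfolding biinitial_def is_cat_equivalence_def nat_isomorphic_def
    by (auto simp: comp_ftor_def id_ftor_def to_terminal_def hom_cat_def)
  have \<tau>: "iso2 (\<tau> a)" "dom2 C (\<tau> a) = on_ob G ()" "cod2 C (\<tau> a) = a" if "a \<in> arr I T" for a
    using bspec[OF iso that]
    by (auto simp: cat_iso_def hom_cat_def iso2_def inverse_cells_def cell_def)
  \<comment> \<open>The only arrow of the terminal category is an identity, so each naturality
    square of \<open>\<tau>\<close> becomes a triangle.\<close>
  have G_id: "on_hom G () () () = \<i> (on_ob G ())"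
    using G by (auto simp: is_functor_def terminal_cat_def hom_cat_def)
  have eq: "\<theta> = \<tau> b \<cdot> inv2 (\<tau> a)" if "\<theta> \<in> cell a b" for \<theta>
  proof -
    have "\<theta> \<cdot> \<tau> a = \<tau> b"
      using nat[rule_format, OF assms(3,4) that] \<tau>[OF assms(4)] by (simp add: G_id vunit iso2_Cell)
    then have "\<tau> b \<cdot> inv2 (\<tau> a) = (\<theta> \<cdot> \<tau> a) \<cdot> inv2 (\<tau> a)"
      by simp
    also have "\<dots> = \<theta>"
      using that \<tau>[OF assms(3)] by (simp add: cell_def vassoc cell_simps inv2_vcomp vunit)
    finally show ?thesis ..
  qed
  have "\<tau> b \<cdot> inv2 (\<tau> a) \<in> icell a b"
    using \<tau>[OF assms(3)] \<tau>[OF assms(4)] by (simp add: icell_iff cell_simps)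
  with eq show ?thesis by blast
qed

lemma biinitial_arr:
  assumes "biinitial I" "T \<in> Obj C"
  shows "\<exists>a. a \<in> arr I T"
  using assms unfolding biinitial_def is_cat_equivalence_def is_functor_def
  by (fastforce simp: terminal_cat_def hom_cat_def)

end

section \<open>Equivalences of categories\<close>

lemma cat_equivalence_ess_surjective:
  assumes "is_cat_equivalence A B F" "y \<in> Ob B"
  shows "\<exists>x \<in> Ob A. \<exists>f. cat_iso B (on_ob F x) y f"
  using assms unfolding is_cat_equivalence_def is_functor_def nat_isomorphic_def
  by (fastforce simp: comp_ftor_def id_ftor_def)

lemma is_functor_comp:
  assumes "is_functor A B F" "is_functor B D G"
  shows "is_functor A D (comp_ftor G F)"
  using assms unfolding is_functor_def comp_ftor_def by simp

lemma is_functor_cat_iso: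
  assumes "is_functor A B F" "x \<in> Ob A" "y \<in> Ob A" "cat_iso A x y f"
  shows "cat_iso B (on_ob F x) (on_ob F y) (on_hom F x y f)"
  using assms unfolding is_functor_def cat_iso_def by metis

text \<open>\<open>U\<close> and \<open>V\<close> form an isomorphism of categories. The
  quasi-inverse is \<open>G\<close> after \<open>V\<close>; one natural isomorphism remains
  \<open>\<tau>\<close>, the other is the image of \<open>\<tau>'\<close> under
  \<open>U\<close>.\<close>

lemma cat_equivalence_comp_isomorphism:
  assumes K: "is_cat_equivalence A B K" and U: "is_functor B D U" and V: "is_functor D B V"
    and VU: "\<And>b. b \<in> Ob B \<Longrightarrow> on_ob V (on_ob U b) = b"
      "\<And>b b' f. b \<in> Ob B \<Longrightarrow> b' \<in> Ob B \<Longrightarrow> f \<in> Hom B b b' \<Longrightarrow>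
        on_hom V (on_ob U b) (on_ob U b') (on_hom U b b' f) = f"
    and UV: "\<And>d. d \<in> Ob D \<Longrightarrow> on_ob U (on_ob V d) = d"
      "\<And>d d' f. d \<in> Ob D \<Longrightarrow> d' \<in> Ob D \<Longrightarrow> f \<in> Hom D d d' \<Longrightarrow>
        on_hom U (on_ob V d) (on_ob V d') (on_hom V d d' f) = f"
  shows "is_cat_equivalence A D (comp_ftor U K)"
proof -
  obtain G \<tau> \<tau>' where KF: "is_functor A B K" and G: "is_functor B A G"
    and \<tau>: "\<forall>x \<in> Ob A. cat_iso A (on_ob G (on_ob K x)) x (\<tau> x)"
      "\<forall>x \<in> Ob A. \<forall>y \<in> Ob A. \<forall>f \<in> Hom A x y.
        Cmp A (\<tau> y) (on_hom G (on_ob K x) (on_ob K y) (on_hom K x y f)) = Cmp A f (\<tau> x)"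
    and \<tau>': "\<forall>b \<in> Ob B. cat_iso B (on_ob K (on_ob G b)) b (\<tau>' b)"
      "\<forall>b \<in> Ob B. \<forall>c \<in> Ob B. \<forall>f \<in> Hom B b c.
        Cmp B (\<tau>' c) (on_hom K (on_ob G b) (on_ob G c) (on_hom G b c f)) = Cmp B f (\<tau>' b)"
    using K unfolding is_cat_equivalence_def nat_isomorphic_def comp_ftor_def id_ftor_def
    by auto
  have Kob: "on_ob K x \<in> Ob B" if "x \<in> Ob A" for x
    using KF that by (simp add: is_functor_def)
  have Khom: "on_hom K x y f \<in> Hom B (on_ob K x) (on_ob K y)"
    if "x \<in> Ob A" "y \<in> Ob A" "f \<in> Hom A x y" for x y f
    using KF that by (simp add: is_functor_def)
  have Gob: "on_ob G b \<in> Ob A" if "b \<in> Ob B" for b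
    using G that by (simp add: is_functor_def)
  have Ghom: "on_hom G x y f \<in> Hom A (on_ob G x) (on_ob G y)"
    if "x \<in> Ob B" "y \<in> Ob B" "f \<in> Hom B x y" for x y f
    using G that by (simp add: is_functor_def)
  have Vob: "on_ob V d \<in> Ob B" if "d \<in> Ob D" for d
    using V that by (simp add: is_functor_def)
  have Vhom: "on_hom V x y f \<in> Hom B (on_ob V x) (on_ob V y)"
    if "x \<in> Ob D" "y \<in> Ob D" "f \<in> Hom D x y" for x y f
    using V that by (simp add: is_functor_def)
  have Ucmp: "Cmp D (on_hom U y z g) (on_hom U x y f) = on_hom U x z (Cmp B g f)"
    if "x \<in> Ob B" "y \<in> Ob B" "z \<in> Ob B" "f \<in> Hom B x y" "g \<in> Hom B y z" for x y z f g
    using U that by (simp add: is_functor_def)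
  let ?G = "comp_ftor G V"
  have "nat_isomorphic A A (comp_ftor ?G (comp_ftor U K)) id_ftor"
    unfolding nat_isomorphic_def
    by (rule exI[of _ \<tau>]) (use \<tau> in \<open>simp add: comp_ftor_def id_ftor_def VU Kob Khom\<close>)
  moreover have "nat_isomorphic D D (comp_ftor (comp_ftor U K) ?G) id_ftor"
    unfolding nat_isomorphic_def
  proof (intro exI conjI ballI)
    \<comment> \<open>The component of \<open>\<tau>'\<close> at \<open>on_ob V d\<close>,
      transported by \<open>U\<close>; its target is \<open>on_ob U (on_ob V d) = d\<close>.\<close>
    let ?\<sigma> = "\<lambda>d. on_hom U (on_ob K (on_ob G (on_ob V d))) (on_ob V d) (\<tau>' (on_ob V d))"
    show "cat_iso D (on_ob (comp_ftor (comp_ftor U K) ?G) d) (on_ob id_ftor d) (?\<sigma> d)"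
      if "d \<in> Ob D" for d
      using is_functor_cat_iso[OF U _ _ bspec[OF \<tau>'(1) Vob[OF that]]] that
      by (simp add: comp_ftor_def id_ftor_def UV Kob Gob Vob)
    fix d d' f assume d: "d \<in> Ob D" "d' \<in> Ob D" and f: "f \<in> Hom D d d'"
    have \<tau>'_hom: "\<tau>' b \<in> Hom B (on_ob K (on_ob G b)) b" if "b \<in> Ob B" for b
      using \<tau>'(1) that by (simp add: cat_iso_def)
    have "Cmp D (?\<sigma> d') (on_hom (comp_ftor (comp_ftor U K) ?G) d d' f)
      = on_hom U (on_ob K (on_ob G (on_ob V d))) (on_ob V d')
        (Cmp B (on_hom V d d' f) (\<tau>' (on_ob V d)))"
      using d f \<tau>'(2) by (simp add: comp_ftor_def Ucmp Kob Khom Gob Ghom Vob Vhom \<tau>'_hom)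
    also have "\<dots> = Cmp D f (?\<sigma> d)"
      using d f Ucmp[of "on_ob K (on_ob G (on_ob V d))" "on_ob V d" "on_ob V d'"
          "\<tau>' (on_ob V d)" "on_hom V d d' f"]
      by (simp add: UV Kob Gob Vob Vhom \<tau>'_hom)
    finally show "Cmp D (?\<sigma> d') (on_hom (comp_ftor (comp_ftor U K) ?G) d d' f)
      = Cmp D (on_hom id_ftor d d' f) (?\<sigma> d)"
      by (simp add: id_ftor_def)
  qed
  ultimately show ?thesis
    unfolding is_cat_equivalence_def using is_functor_comp[OF KF U] is_functor_comp[OF V G] by blast
qed

context bicategory
begin

text \<open>Parallel arrows out of \<open>I\<close> are joined by exactly one 2-cell, so the square
  in a cocone carries no information and the cocone category is isomorphic to a product of
  hom-categories.\<close>

lemma bicoproduct_if_biPushout_biinitial: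
  assumes I: "biinitial I" and u: "u \<in> arr I X" and v: "v \<in> arr I Y"
    and po: "biPushout u v Q i \<phi> j"
  shows "bicoproduct X Y Q i j"
  unfolding bicoproduct_def
proof (intro conjI ballI)
  have uv: "u \<in> Arr C" "src C u = I" "trg C u = X" "v \<in> Arr C" "src C v = I" "trg C v = Y"
    using u v by (auto simp: arr_def)
  show ij: "i \<in> arr X Q" "j \<in> arr Y Q"
    using po uv by (auto simp: biPushout_def cocone_cat_def)
  fix T assume T: "T \<in> Obj C"
  \<comment> \<open>The unique filler of the square, chosen as a function of \<open>a\<close> and
    \<open>b\<close> in order to define \<open>?V\<close> on objects.\<close>
  define sq where "sq a b = (SOME \<sigma>. \<sigma> \<in> icell (a \<star> u) (b \<star> v))" for a b
  have unique: "\<sigma> = \<sigma>'"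
    if "a \<in> arr I T" "b \<in> arr I T" "\<sigma> \<in> cell a b" "\<sigma>' \<in> cell a b" for a b \<sigma> \<sigma>'
    using biinitial_cell_unique[OF I T that(1,2)] that(3,4) by metis
  have sq: "sq a b \<in> icell (a \<star> u) (b \<star> v)" if "a \<in> arr X T" "b \<in> arr Y T" for a b
    unfolding sq_def some_in_eq
    using biinitial_cell_unique[OF I T comp1_arr[OF u that(1)] comp1_arr[OF v that(2)]] by blast
  have sq_unique: "sq a b = \<sigma>"
    if "a \<in> arr X T" "b \<in> arr Y T" "\<sigma> \<in> icell (a \<star> u) (b \<star> v)" for a b \<sigma>
    using unique[OF comp1_arr[OF u that(1)] comp1_arr[OF v that(2)]] sq[OF that(1,2)] that(3)
    by (simp add: icell_def)
  \<comment> \<open>Both composites are parallel 2-cells between arrows out of \<open>I\<close>, so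
    compatibility is automatic.\<close>
  have square: "(\<beta> \<lhd> v) \<cdot> \<sigma> = \<sigma>' \<cdot> (\<alpha> \<lhd> u)"
    if "a \<in> arr X T" "b \<in> arr Y T" "a' \<in> arr X T" "b' \<in> arr Y T" "\<alpha> \<in> cell a a'" "\<beta> \<in> cell b b'"
      "\<sigma> \<in> icell (a \<star> u) (b \<star> v)" "\<sigma>' \<in> icell (a' \<star> u) (b' \<star> v)" for a b a' b' \<alpha> \<beta> \<sigma> \<sigma>'
    by (rule unique[OF comp1_arr[OF u that(1)] comp1_arr[OF v that(4)]])
      (use that uv in \<open>simp_all add: arr_def cell_def icell_iff cell_simps\<close>)
  let ?B = "cocone_cat u v T" and ?D = "prod_cat (hom_cat X T) (hom_cat Y T)"
  \<comment> \<open>\<open>?U\<close> forgets the square and \<open>?V\<close> restores the unique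
    one; both are the identity on pairs of 2-cells.\<close>
  let ?U = "\<lparr>on_ob = \<lambda>(a, \<sigma>, b). (a, b), on_hom = \<lambda>_ _ c. c\<rparr>"
    and ?V = "\<lparr>on_ob = \<lambda>(a, b). (a, sq a b, b), on_hom = \<lambda>_ _ c. c\<rparr>"
  note defs = cocone_cat_def prod_cat_def hom_cat_def
  have K: "is_cat_equivalence (hom_cat Q T) ?B (paste_cocone u v i \<phi> j)"
    using po T by (simp add: biPushout_def)
  have U: "is_functor ?B ?D ?U"
    by (auto simp: is_functor_def defs uv)
  have V: "is_functor ?D ?B ?V"
    by (auto simp: is_functor_def defs uv sq intro: square[OF _ _ _ _ _ _ sq sq])
  have "is_cat_equivalence (hom_cat Q T) ?D (comp_ftor ?U (paste_cocone u v i \<phi> j))"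
    by (rule cat_equivalence_comp_isomorphism[OF K U V])
      (auto simp: defs uv sq_unique)
  then show "is_cat_equivalence (hom_cat Q T) ?D
      \<lparr>on_ob = \<lambda>t. (t \<star> i, t \<star> j), on_hom = \<lambda>_ _ \<theta>. (\<theta> \<lhd> i, \<theta> \<lhd> j)\<rparr>"
    by (simp add: comp_ftor_def paste_cocone_def)
qed

lemma bicoproduct_lift:
  assumes S: "bicoproduct X Y S i j" and a: "a \<in> arr X T" and b: "b \<in> arr Y T"
  obtains t where "t \<in> arr S T" "t \<star> i \<cong> a" "t \<star> j \<cong> b"
proof -
  let ?D = "prod_cat (hom_cat X T) (hom_cat Y T)"
  have "T \<in> Obj C"
    using a src_trg by (auto simp: arr_def)
  then obtain t \<pi> \<omega> where t: "t \<in> arr S T" and iso: "cat_iso ?D (t \<star> i, t \<star> j) (a, b) (\<pi>, \<omega>)"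
    using S cat_equivalence_ess_surjective[of "hom_cat S T" ?D _ "(a, b)"] a b
    by (fastforce simp: bicoproduct_def prod_cat_def hom_cat_def)
  from iso have "\<pi> \<in> icell (t \<star> i) a" "\<omega> \<in> icell (t \<star> j) b"
    by (auto simp: cat_iso_def prod_cat_def hom_cat_def icell_def inverse_cells_def cell_def)
  with t show thesis
    using that by (auto simp: iso_arr_def)
qed

section \<open>Lifting along biPullbacks and the ends of a cylinder\<close>

lemma biPullback_arr:
  assumes "biPullback f g P p \<phi> q" "f \<in> arr B D" "g \<in> arr E D"
  shows "p \<in> arr P B" "q \<in> arr P E" "\<phi> \<in> icell (f \<star> p) (g \<star> q)"
  using assms by (auto simp: biPullback_def cone_cat_def arr_def)

text \<open>Essential surjectivity of the pasting functor. An isomorphism of cones consists of two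
  invertible 2-cells and a compatibility equation, which is the last conclusion.\<close>

lemma biPullback_lift:
  assumes pb: "biPullback f g P p \<phi> q" and f: "f \<in> arr B D" and g: "g \<in> arr E D"
    and u: "u \<in> arr T B" and v: "v \<in> arr T E" and \<sigma>: "\<sigma> \<in> icell (f \<star> u) (g \<star> v)"
  obtains t \<pi> \<omega> where "t \<in> arr T P" "\<pi> \<in> icell (p \<star> t) u" "\<omega> \<in> icell (q \<star> t) v"
    "(g \<rhd> \<omega>) \<cdot> paste f g p \<phi> q t = \<sigma> \<cdot> (f \<rhd> \<pi>)"
proof -
  let ?B = "cone_cat f g T"
  have "T \<in> Obj C"
    using u src_trg by (auto simp: arr_def)
  then obtain t \<pi> \<omega> where t: "t \<in> arr T P"
    and iso: "cat_iso ?B (p \<star> t, paste f g p \<phi> q t, q \<star> t) (u, \<sigma>, v) (\<pi>, \<omega>)"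
    using pb cat_equivalence_ess_surjective[of "hom_cat T P" ?B _ "(u, \<sigma>, v)"] assms(2-)
    by (fastforce simp: biPullback_def cone_cat_def hom_cat_def arr_def paste_def paste_cone_def)
  from iso have "\<pi> \<in> icell (p \<star> t) u" "\<omega> \<in> icell (q \<star> t) v"
    "(g \<rhd> \<omega>) \<cdot> paste f g p \<phi> q t = \<sigma> \<cdot> (f \<rhd> \<pi>)"
    by (auto simp: cat_iso_def cone_cat_def icell_def inverse_cells_def cell_def)
  with t show thesis
    using that by blast
qed

text \<open>The lift \<open>e\<close> is fixed before \<open>m\<close> and \<open>n\<close>, since
  the later factorization depends on both ends at once. The equation is the cylinder morphism
  condition at one end, for \<open>k = p \<star> m\<close>, \<open>l = x\<close>,
  \<open>\<mu>\<close> the pasted square and \<open>\<nu> = inv2 (\<r> x)\<close>.\<close>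

lemma biPullback_cylinder_end:
  assumes pb: "biPullback s x P p \<phi> q" and s: "s \<in> arr W Z" and x: "x \<in> arr X Z"
    and d: "d \<in> arr X W" and \<alpha>: "\<alpha> \<in> icell (s \<star> d) x"
  shows "\<exists>e \<in> arr X P. \<forall>V. \<forall>m \<in> arr V P. \<forall>n \<in> arr X V. m \<star> n \<cong> e \<longrightarrow>
      (\<exists>\<alpha>' \<in> icell ((q \<star> m) \<star> n) (\<one> X). \<exists>\<gamma> \<in> icell d ((p \<star> m) \<star> n).
        (x \<rhd> \<alpha>') \<cdot> \<a> x (q \<star> m) n \<cdot> (paste s x p \<phi> q m \<lhd> n) \<cdot> inv2 (\<a> s (p \<star> m) n) \<cdot> (s \<rhd> \<gamma>)
          = inv2 (\<r> x) \<cdot> \<alpha>)"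
proof -
  have X: "X \<in> Obj C"
    using x src_trg by (auto simp: arr_def)
  note pq = biPullback_arr[OF pb s x]
  \<comment> \<open>The unitor makes \<open>\<alpha>\<close> end at
    \<open>x \<star> \<one> X\<close>, so that \<open>d\<close> and \<open>\<one> X\<close> form a
    cone and the lift is a section of \<open>q\<close> up to isomorphism.\<close>
  let ?\<sigma> = "inv2 (\<r> x) \<cdot> \<alpha>"
  have \<sigma>: "?\<sigma> \<in> icell (s \<star> d) (x \<star> \<one> X)"
    using \<alpha> x by (simp add: icell_iff arr_def cell_simps)
  obtain e \<pi> \<omega> where e: "e \<in> arr X P" and \<pi>: "\<pi> \<in> icell (p \<star> e) d"
    and \<omega>: "\<omega> \<in> icell (q \<star> e) (\<one> X)" and eq: "(x \<rhd> \<omega>) \<cdot> paste s x p \<phi> q e = ?\<sigma> \<cdot> (s \<rhd> \<pi>)"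
    using biPullback_lift[OF pb s x d id1_arr[OF X] \<sigma>] .
  show ?thesis
  proof (intro bexI[OF _ e] allI ballI impI)
    fix V m n assume m: "m \<in> arr V P" and n: "n \<in> arr X V" and "m \<star> n \<cong> e"
    then obtain \<theta> where \<theta>: "\<theta> \<in> icell (m \<star> n) e"
      by (auto simp: iso_arr_def)
    note ty = s[unfolded arr_def] x[unfolded arr_def] d[unfolded arr_def] pq[unfolded arr_def icell_iff]
      e[unfolded arr_def] m[unfolded arr_def] n[unfolded arr_def] \<theta>[unfolded icell_iff]
      \<pi>[unfolded icell_iff] \<omega>[unfolded icell_iff] \<sigma>[unfolded icell_iff] id1_simps[OF X]
    \<comment> \<open>The cone isomorphism transported from \<open>e\<close> to
      \<open>m \<star> n\<close> and reassociated. The required witnesses are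
      \<open>\<omega>'\<close> for \<open>\<alpha>'\<close> and \<open>inv2 \<pi>'\<close> for
      \<open>\<gamma>\<close>.\<close>
    define \<pi>' where "\<pi>' = \<pi> \<cdot> (p \<rhd> \<theta>) \<cdot> \<a> p m n"
    define \<omega>' where "\<omega>' = \<omega> \<cdot> (q \<rhd> \<theta>) \<cdot> \<a> q m n"
    have \<pi>': "iso2 \<pi>'" "dom2 C \<pi>' = (p \<star> m) \<star> n" "cod2 C \<pi>' = d"
      using ty by (simp_all add: \<pi>'_def cell_simps)
    have \<omega>': "iso2 \<omega>'" "dom2 C \<omega>' = (q \<star> m) \<star> n" "cod2 C \<omega>' = \<one> X"
      using ty by (simp_all add: \<omega>'_def cell_simps)
    let ?\<mu> = "paste s x p \<phi> q m"
    let ?PP = "paste s x (p \<star> m) ?\<mu> (q \<star> m) n"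
    note paste_ty =
      paste_icell[OF pq(3,1,2) s x m, unfolded icell_iff]
      paste_icell[OF pq(3,1,2) s x e, unfolded icell_iff]
      paste_icell[OF pq(3,1,2) s x comp1_arr[OF n m], unfolded icell_iff]
      paste_icell[OF paste_icell[OF pq(3,1,2) s x m] comp1_arr[OF m pq(1)] comp1_arr[OF m pq(2)]
        s x n, unfolded icell_iff]
    have \<theta>_cell: "\<theta> \<in> cell (m \<star> n) e"
      using \<theta> by (simp add: icell_def)
    \<comment> \<open>The chain expands \<open>\<omega>'\<close>, merges the two pastings, slides
      \<open>\<theta>\<close> across the square, and ends with the compatibility \<open>eq\<close>
      of the lift.\<close>
    have "(x \<rhd> \<omega>') \<cdot> ?PP = (x \<rhd> \<omega>) \<cdot> (x \<rhd> q \<rhd> \<theta>) \<cdot> ((x \<rhd> \<a> q m n) \<cdot> ?PP)"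
    proof -
      have "x \<rhd> \<omega>' = (x \<rhd> \<omega>) \<cdot> (x \<rhd> q \<rhd> \<theta>) \<cdot> (x \<rhd> \<a> q m n)"
        using ty unfolding \<omega>'_def by (simp add: hcomp_vcomp cell_simps vunit)
      then show ?thesis
        using ty paste_ty by (simp add: vassoc cell_simps)
    qed
    also have "\<dots> = (x \<rhd> \<omega>) \<cdot> ((x \<rhd> q \<rhd> \<theta>) \<cdot> paste s x p \<phi> q (m \<star> n)) \<cdot> (s \<rhd> \<a> p m n)"
      using ty paste_ty unfolding paste_paste[OF pq(3,1,2) s x m n] by (simp add: vassoc cell_simps)
    also have "\<dots> = ((x \<rhd> \<omega>) \<cdot> paste s x p \<phi> q e) \<cdot> (s \<rhd> p \<rhd> \<theta>) \<cdot> (s \<rhd> \<a> p m n)"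
      using ty paste_ty unfolding paste_natural[OF pq(3,1,2) s x comp1_arr[OF n m] e \<theta>_cell]
      by (simp add: vassoc cell_simps)
    also have "\<dots> = ?\<sigma> \<cdot> (s \<rhd> \<pi>')"
      using ty unfolding eq \<pi>'_def by (simp add: vassoc hcomp_vcomp cell_simps vunit)
    finally have *: "(x \<rhd> \<omega>') \<cdot> ?PP = ?\<sigma> \<cdot> (s \<rhd> \<pi>')" .
    have "(x \<rhd> \<omega>') \<cdot> \<a> x (q \<star> m) n \<cdot> (?\<mu> \<lhd> n) \<cdot> inv2 (\<a> s (p \<star> m) n) \<cdot> (s \<rhd> inv2 \<pi>')
      = ((x \<rhd> \<omega>') \<cdot> ?PP) \<cdot> (s \<rhd> inv2 \<pi>')"
      using ty \<pi>' \<omega>' paste_ty unfolding paste_def[of s x "p \<star> m"] by (simp add: vassoc cell_simps)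
    also have "\<dots> = ?\<sigma> \<cdot> ((s \<rhd> \<pi>') \<cdot> (s \<rhd> inv2 \<pi>'))"
      using ty \<pi>' unfolding * by (simp add: vassoc cell_simps)
    also have "(s \<rhd> \<pi>') \<cdot> (s \<rhd> inv2 \<pi>') = \<i> (s \<star> d)"
      using ty \<pi>' by (simp add: hcomp_vcomp cell_simps vunit inv2_vcomp id2_hcomp_id2)
    also have "?\<sigma> \<cdot> \<i> (s \<star> d) = ?\<sigma>"
      using ty by (simp add: vunit iso2_Cell)
    finally show "\<exists>\<alpha>' \<in> icell ((q \<star> m) \<star> n) (\<one> X). \<exists>\<gamma> \<in> icell d ((p \<star> m) \<star> n).
        (x \<rhd> \<alpha>') \<cdot> \<a> x (q \<star> m) n \<cdot> (?\<mu> \<lhd> n) \<cdot> inv2 (\<a> s (p \<star> m) n) \<cdot> (s \<rhd> \<gamma>) = ?\<sigma>"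
      using \<pi>' \<omega>' by (intro bexI[of _ \<omega>'] bexI[of _ "inv2 \<pi>'"]) (auto simp: icell_iff inv2_simps)
  qed
qed

end


section \<open>Replacing a fibrant w-homotopy by a fibrant q-homotopy\<close>

context model_bicategory
begin

lemma bicoproduct_exists:
  assumes "X \<in> Obj C" "Y \<in> Obj C"
  shows "\<exists>S i j. bicoproduct X Y S i j"
proof -
  obtain I where I: "biinitial I"
    using M0_biinitial by blast
  obtain u v where uv: "u \<in> arr I X" "v \<in> arr I Y"
    using biinitial_arr[OF I] assms by blast
  obtain Q i \<phi> j where "biPushout u v Q i \<phi> j"
    using M0_biPushout[of u v] uv by (auto simp: arr_def)
  then show ?thesis
    using bicoproduct_if_biPushout_biinitial[OF I uv] by blast
qed

text \<open>The homotopy is taken in constructor form, so that the recursive predicates unfold on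
  its components.\<close>

lemma fibrant_q_homotopy_germ_related:
  assumes H: "left_w_homotopy X Y f g (Hpy (Cyl W Z d\<^sub>0 d\<^sub>1 x s \<alpha>\<^sub>0 \<alpha>\<^sub>1) h \<eta> \<epsilon>)" and s_Fib: "s \<in> Fib C"
  shows "\<exists>H'. left_q_homotopy X Y f g H' \<and> fibrant H' \<and>
    germ_related X Y f g H' (Hpy (Cyl W Z d\<^sub>0 d\<^sub>1 x s \<alpha>\<^sub>0 \<alpha>\<^sub>1) h \<eta> \<epsilon>)"
proof -
  have f: "f \<in> arr X Y" and g: "g \<in> arr X Y" and d\<^sub>0: "d\<^sub>0 \<in> arr X W" and d\<^sub>1: "d\<^sub>1 \<in> arr X W"
    and x: "x \<in> arr X Z" and s: "s \<in> arr W Z" and s_WE: "s \<in> WE C"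
    and \<alpha>\<^sub>0: "\<alpha>\<^sub>0 \<in> icell (s \<star> d\<^sub>0) x" and \<alpha>\<^sub>1: "\<alpha>\<^sub>1 \<in> icell (s \<star> d\<^sub>1) x"
    and h: "h \<in> arr W Y" and \<eta>: "\<eta> \<in> cell f (h \<star> d\<^sub>0)" and \<epsilon>: "\<epsilon> \<in> cell (h \<star> d\<^sub>1) g"
    using H by auto
  have X: "X \<in> Obj C"
    using x src_trg by (auto simp: arr_def)
  obtain P p \<phi> q where pb: "biPullback s x P p \<phi> q"
    using M0_biPullback[of s x] s x by (auto simp: arr_def)
  note p = biPullback_arr(1)[OF pb s x] and q = biPullback_arr(2)[OF pb s x]
    and \<phi> = biPullback_arr(3)[OF pb s x]
  \<comment> \<open>The leg \<open>q\<close> opposite to \<open>s\<close> is the base change of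
    \<open>s\<close>, hence a fibration by M3 and a weak equivalence by M4.\<close>
  have q_Fib: "q \<in> Fib C" and q_WE: "q \<in> WE C"
    using M3_fib_biPullback[OF pb] M4_biPullback[OF pb] s_Fib s_WE by auto
  obtain e\<^sub>0 where e\<^sub>0: "e\<^sub>0 \<in> arr X P" and end\<^sub>0: "\<forall>V. \<forall>m \<in> arr V P. \<forall>n \<in> arr X V.
      m \<star> n \<cong> e\<^sub>0 \<longrightarrow> (\<exists>\<alpha>' \<in> icell ((q \<star> m) \<star> n) (\<one> X). \<exists>\<gamma> \<in> icell d\<^sub>0 ((p \<star> m) \<star> n).
        (x \<rhd> \<alpha>') \<cdot> \<a> x (q \<star> m) n \<cdot> (paste s x p \<phi> q m \<lhd> n) \<cdot> inv2 (\<a> s (p \<star> m) n) \<cdot> (s \<rhd> \<gamma>)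
          = inv2 (\<r> x) \<cdot> \<alpha>\<^sub>0)"
    using biPullback_cylinder_end[OF pb s x d\<^sub>0 \<alpha>\<^sub>0] by blast
  obtain e\<^sub>1 where e\<^sub>1: "e\<^sub>1 \<in> arr X P" and end\<^sub>1: "\<forall>V. \<forall>m \<in> arr V P. \<forall>n \<in> arr X V.
      m \<star> n \<cong> e\<^sub>1 \<longrightarrow> (\<exists>\<alpha>' \<in> icell ((q \<star> m) \<star> n) (\<one> X). \<exists>\<gamma> \<in> icell d\<^sub>1 ((p \<star> m) \<star> n).
        (x \<rhd> \<alpha>') \<cdot> \<a> x (q \<star> m) n \<cdot> (paste s x p \<phi> q m \<lhd> n) \<cdot> inv2 (\<a> s (p \<star> m) n) \<cdot> (s \<rhd> \<gamma>)
          = inv2 (\<r> x) \<cdot> \<alpha>\<^sub>1)"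
    using biPullback_cylinder_end[OF pb s x d\<^sub>1 \<alpha>\<^sub>1] by blast
  obtain S i\<^sub>0 i\<^sub>1 where S: "bicoproduct X X S i\<^sub>0 i\<^sub>1"
    using bicoproduct_exists[OF X X] by blast
  have i\<^sub>0: "i\<^sub>0 \<in> arr X S" and i\<^sub>1: "i\<^sub>1 \<in> arr X S"
    using S by (auto simp: bicoproduct_def)
  obtain u where u: "u \<in> arr S P" "u \<star> i\<^sub>0 \<cong> e\<^sub>0" "u \<star> i\<^sub>1 \<cong> e\<^sub>1"
    using bicoproduct_lift[OF S e\<^sub>0 e\<^sub>1] .
  \<comment> \<open>The weak equivalence is placed on the fibration side, so that
    \<open>q \<star> m\<close> is a trivial fibration while \<open>c\<close> is a
    cofibration.\<close>
  obtain V c m where c: "c \<in> arr S V" "c \<in> Cof C" and m: "m \<in> arr V P"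
    and m_Fib: "m \<in> Fib C" and m_WE: "m \<in> WE C" and cm: "u \<cong> m \<star> c"
    using M2_fib_we[OF u(1)] by blast
  \<comment> \<open>Provides the premise of \<open>end\<^sub>0\<close> and
    \<open>end\<^sub>1\<close> for the end inclusions \<open>c \<star> i\<^sub>0\<close> and
    \<open>c \<star> i\<^sub>1\<close>.\<close>
  have factor: "m \<star> (c \<star> i) \<cong> e" if "i \<in> arr X S" "u \<star> i \<cong> e" for i e
    using that iso_arr_trans iso_arr_sym iso_arr_assoc[OF that(1) c(1) m]
      iso_arr_whisker_right[OF cm that(1) u(1)] by metis
  let ?n\<^sub>0 = "c \<star> i\<^sub>0" and ?n\<^sub>1 = "c \<star> i\<^sub>1" and ?k = "p \<star> m" and ?\<mu> = "paste s x p \<phi> q m"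
    and ?\<rho> = "\<i> (h \<star> p \<star> m)"
  have n\<^sub>0: "?n\<^sub>0 \<in> arr X V" and n\<^sub>1: "?n\<^sub>1 \<in> arr X V"
    using comp1_arr i\<^sub>0 i\<^sub>1 c(1) by auto
  obtain \<beta>\<^sub>0 \<gamma>\<^sub>0 where \<beta>\<^sub>0: "\<beta>\<^sub>0 \<in> icell ((q \<star> m) \<star> ?n\<^sub>0) (\<one> X)" and \<gamma>\<^sub>0: "\<gamma>\<^sub>0 \<in> icell d\<^sub>0 (?k \<star> ?n\<^sub>0)"
    and eq\<^sub>0: "(x \<rhd> \<beta>\<^sub>0) \<cdot> \<a> x (q \<star> m) ?n\<^sub>0 \<cdot> (?\<mu> \<lhd> ?n\<^sub>0) \<cdot> inv2 (\<a> s ?k ?n\<^sub>0) \<cdot> (s \<rhd> \<gamma>\<^sub>0)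
      = inv2 (\<r> x) \<cdot> \<alpha>\<^sub>0"
    using end\<^sub>0[rule_format, OF m n\<^sub>0 factor[OF i\<^sub>0 u(2)]] by blast
  obtain \<beta>\<^sub>1 \<gamma>\<^sub>1 where \<beta>\<^sub>1: "\<beta>\<^sub>1 \<in> icell ((q \<star> m) \<star> ?n\<^sub>1) (\<one> X)" and \<gamma>\<^sub>1: "\<gamma>\<^sub>1 \<in> icell d\<^sub>1 (?k \<star> ?n\<^sub>1)"
    and eq\<^sub>1: "(x \<rhd> \<beta>\<^sub>1) \<cdot> \<a> x (q \<star> m) ?n\<^sub>1 \<cdot> (?\<mu> \<lhd> ?n\<^sub>1) \<cdot> inv2 (\<a> s ?k ?n\<^sub>1) \<cdot> (s \<rhd> \<gamma>\<^sub>1)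
      = inv2 (\<r> x) \<cdot> \<alpha>\<^sub>1"
    using end\<^sub>1[rule_format, OF m n\<^sub>1 factor[OF i\<^sub>1 u(3)]] by blast
  have qm: "q \<star> m \<in> arr V X" and k: "?k \<in> arr V W" and hk: "h \<star> ?k \<in> arr V Y"
    using comp1_arr m p q h by blast+
  have qm_Fib: "q \<star> m \<in> Fib C"
    using M3_fib_comp[OF m_Fib q_Fib] m q by (simp add: arr_def)
  have qm_WE: "q \<star> m \<in> WE C"
    using M5[OF m q iso_arr_refl] qm m_WE q_WE by (auto simp: arr_def)
  note ty = h[unfolded arr_def] k[unfolded arr_def] n\<^sub>0[unfolded arr_def] n\<^sub>1[unfolded arr_def]
    d\<^sub>0[unfolded arr_def] d\<^sub>1[unfolded arr_def] \<gamma>\<^sub>0[unfolded icell_iff] \<gamma>\<^sub>1[unfolded icell_iff]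
    \<eta>[unfolded cell_def] \<epsilon>[unfolded cell_def] x[unfolded arr_def]
  \<comment> \<open>These 2-cells are read off from the two equations in \<open>germ_square\<close>,
    with \<open>?\<rho>\<close> an identity; the equations then hold by definition.\<close>
  define \<eta>' where "\<eta>' = (?\<rho> \<lhd> ?n\<^sub>0) \<cdot> inv2 (\<a> h ?k ?n\<^sub>0) \<cdot> (h \<rhd> \<gamma>\<^sub>0) \<cdot> \<eta>"
  define \<epsilon>' where "\<epsilon>' = \<epsilon> \<cdot> (h \<rhd> inv2 \<gamma>\<^sub>1) \<cdot> \<a> h ?k ?n\<^sub>1 \<cdot> (inv2 ?\<rho> \<lhd> ?n\<^sub>1)"
  have \<eta>': "\<eta>' \<in> cell f ((h \<star> ?k) \<star> ?n\<^sub>0)" and \<epsilon>': "\<epsilon>' \<in> cell ((h \<star> ?k) \<star> ?n\<^sub>1) g"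
    using ty unfolding \<eta>'_def \<epsilon>'_def cell_def by (simp_all add: cell_simps)
  define K where "K = Cyl V X ?n\<^sub>0 ?n\<^sub>1 (\<one> X) (q \<star> m) \<beta>\<^sub>0 \<beta>\<^sub>1"
  have K_w: "w_cylinder X K"
    unfolding K_def using n\<^sub>0 n\<^sub>1 qm qm_WE \<beta>\<^sub>0 \<beta>\<^sub>1 id1_arr[OF X] by simp
  \<comment> \<open>The cofibration \<open>c\<close> itself is the arrow out of the bicoproduct, and
    its restrictions are the ends on the nose.\<close>
  have "?n\<^sub>0 \<cong> ?n\<^sub>0" "?n\<^sub>1 \<cong> ?n\<^sub>1"
    using n\<^sub>0 n\<^sub>1 iso_arr_refl by (auto simp: arr_def)
  then have K_q: "q_cylinder X K"
    using K_w S c unfolding K_def q_cylinder.simps by blast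
  have K_H: "left_w_homotopy X Y f g (Hpy K (h \<star> ?k) \<eta>' \<epsilon>')"
    using K_w unfolding K_def using f g hk \<eta>' \<epsilon>' by simp
  \<comment> \<open>The two coherence conditions are \<open>eq\<^sub>0\<close> and
    \<open>eq\<^sub>1\<close>; the new cylinder has base \<open>X\<close>, so \<open>\<nu>\<close>
    only has to insert \<open>\<one> X\<close>.\<close>
  have mor: "cylinder_morphism K (Cyl W Z d\<^sub>0 d\<^sub>1 x s \<alpha>\<^sub>0 \<alpha>\<^sub>1) (Mor ?k x \<gamma>\<^sub>0 \<gamma>\<^sub>1 ?\<mu> (inv2 (\<r> x)))"
    unfolding K_def using k x \<gamma>\<^sub>0 \<gamma>\<^sub>1 eq\<^sub>0 eq\<^sub>1 paste_icell[OF \<phi> p q s x m] ty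
    by (simp add: icell_iff cell_simps)
  have \<rho>: "?\<rho> \<in> icell (h \<star> ?k) (h \<star> ?k)"
    using hk by (simp add: icell_iff arr_def cell_simps)
  have germ: "germ_square (Hpy K (h \<star> ?k) \<eta>' \<epsilon>') (Hpy (Cyl W Z d\<^sub>0 d\<^sub>1 x s \<alpha>\<^sub>0 \<alpha>\<^sub>1) h \<eta> \<epsilon>)
      (Mor ?k x \<gamma>\<^sub>0 \<gamma>\<^sub>1 ?\<mu> (inv2 (\<r> x))) ?\<rho>"
    using mor \<rho> \<eta>'_def \<epsilon>'_def unfolding K_def germ_square.simps by blast
  have "left_q_homotopy X Y f g (Hpy K (h \<star> ?k) \<eta>' \<epsilon>')"
    using K_H K_q by simp
  moreover have "fibrant (Hpy K (h \<star> ?k) \<eta>' \<epsilon>')"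
    unfolding K_def using qm_Fib by simp
  moreover have "germ_related X Y f g (Hpy K (h \<star> ?k) \<eta>' \<epsilon>') (Hpy (Cyl W Z d\<^sub>0 d\<^sub>1 x s \<alpha>\<^sub>0 \<alpha>\<^sub>1) h \<eta> \<epsilon>)"
    unfolding germ_related_def using K_H H germ by blast
  ultimately show ?thesis
    by blast
qed

end

theorem lemma4p36:
  fixes C :: "('o, 'a, 'c, 'z) model_bicat_scheme"
    and X Y :: 'o and f g :: 'a
    and H :: "('o, 'a, 'c) homotopy"
  assumes "model_bicategory C"
    and "f \<in> bicategory_data.arr C X Y"
    and "g \<in> bicategory_data.arr C X Y"
    and "model_bicategory.left_w_homotopy C X Y f g H"
    and "model_bicategory.fibrant C H"
  shows "\<exists>H'. model_bicategory.left_q_homotopy C X Y f g H' \<and>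
    model_bicategory.fibrant C H' \<and>
    model_bicategory.germ_related C X Y f g H' H"
proof -
  interpret model_bicategory C by fact
  obtain W Z d\<^sub>0 d\<^sub>1 x s \<alpha>\<^sub>0 \<alpha>\<^sub>1 h \<eta> \<epsilon> where "H = Hpy (Cyl W Z d\<^sub>0 d\<^sub>1 x s \<alpha>\<^sub>0 \<alpha>\<^sub>1) h \<eta> \<epsilon>"
    by (metis homotopy.exhaust cylinder.exhaust)
  then show ?thesis
    using assms(4,5) fibrant_q_homotopy_germ_related by simp
qed

end
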